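(* Let $K\ge1$. For $i=1,\dots,K$ let $\theta^{(i)}>0$ and $\tau^{(i)}\neq0$ be constants. Let $0<\Delta\le\min\{\theta^{(i)}/\tau^{(i)}:\tau^{(i)}>0\}$ if $\tau^{(i)}>0$ for some $i$, and $0<\Delta\le\infty$ otherwise. Let $X^{(1)},\dots,X^{(K)}$ be independent, with $X^{(i)}$ a $(\theta^{(i)},\tau^{(i)})$ GMSI process on $[0,\Delta)$, let $k_1,\dots,k_K$ be real constants, not all zero, and let $X(t)=\sum_{i=1}^Kk_iX^{(i)}(t)$ for $0\le t<\Delta$. Let $0\le u<\Delta$ and $\vec x=(x_1,\dots,x_K)\in\mathbb R^K$, and let $\{X_{u;\vec x}(h):0\le h<\Delta-u\}$ denote the process $$X_{u;\vec x}(h)=X(u+h)-X(u)+h\sum_{i=1}^K\frac{k_ix_i}{\theta^{(i)}/\tau^{(i)}-u}\quad\text{conditional on }X^{(i)}(u)=x_i\text{ for }i=1,\dots,K .$$ Then $X_{u;\vec x}$ is a $(\theta,\tau_u)$ GMSI process on $[0,\Delta-u)$, where $$\theta=\sum_{i=1}^Kk_i^2\theta^{(i)},\qquad \tau_u=\sum_{i=1}^Kk_i^2\frac{\theta^{(i)}}{\theta^{(i)}/\tau^{(i)}-u}\le\frac{\theta}{\Delta-u}.$$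
   Context: A $(\theta,\tau)$ GMSI process on $[0,\Delta)$ (where $0<\Delta\le\infty$, $\theta>0$, $\tau\le\theta/\Delta$, with $\theta/\infty=0$) is a real, continuous, zero-mean Gaussian Markov process $X$ with $X(0)=0$, stationary increments, and covariance $E[X(s)X(t)]=s(\theta-\tau t)$ for $0\le s\le t<\Delta$. "Conditional on $X^{(i)}(u)=x_i$" means under the regular conditional law given these values (the usual Gaussian conditional law, defined for every $\vec x\in\mathbb{R}^K$ when $u>0$). When $u=0$ one must have $\vec x=\vec 0$ since $X^{(i)}(0)=0$. *)

theory Defs
  imports "HOL-Probability.Probability"
begin

definition time_interval :: "ereal \<Rightarrow> real set" where
  "time_interval \<Delta> = {t. 0 \<le> t \<and> ereal t < \<Delta>}"

(* Normal law, point masses (zero variance) included. *)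
definition gaussian_rv :: "'a measure \<Rightarrow> ('a \<Rightarrow> real) \<Rightarrow> bool" where
  "gaussian_rv M Z \<longleftrightarrow> Z \<in> borel_measurable M \<and>
     ((\<exists>\<mu>. AE \<omega> in M. Z \<omega> = \<mu>) \<or>
      (\<exists>\<mu> \<sigma>. \<sigma> > 0 \<and> distributed M lborel Z (\<lambda>z. ennreal (normal_density \<mu> \<sigma> z))))"

definition gaussian_process :: "'a measure \<Rightarrow> real set \<Rightarrow> (real \<Rightarrow> 'a \<Rightarrow> real) \<Rightarrow> bool" where
  "gaussian_process M T X \<longleftrightarrow>
     (\<forall>J c. finite J \<and> J \<subseteq> T \<longrightarrow> gaussian_rv M (\<lambda>\<omega>. \<Sum>t\<in>J. c t * X t \<omega>))"

definition past_algebra :: "'a measure \<Rightarrow> real set \<Rightarrow> (real \<Rightarrow> 'a \<Rightarrow> real) \<Rightarrow> real \<Rightarrow> 'a measure" where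
  "past_algebra M T X s =
     vimage_algebra (space M) (\<lambda>\<omega>. \<lambda>r\<in>{r\<in>T. r \<le> s}. X r \<omega>) (\<Pi>\<^sub>M r\<in>{r\<in>T. r \<le> s}. borel)"

definition markov_process :: "'a measure \<Rightarrow> real set \<Rightarrow> (real \<Rightarrow> 'a \<Rightarrow> real) \<Rightarrow> bool" where
  "markov_process M T X \<longleftrightarrow>
     (\<forall>s\<in>T. \<forall>t\<in>T. s \<le> t \<longrightarrow> (\<forall>A\<in>sets (borel :: real measure).
        AE \<omega> in M.
          real_cond_exp M (past_algebra M T X s) (\<lambda>\<omega>'. indicator A (X t \<omega>')) \<omega> =
          real_cond_exp M (vimage_algebra (space M) (X s) borel) (\<lambda>\<omega>'. indicator A (X t \<omega>')) \<omega>))"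

(* The joint law of the increments from s does not depend on s. *)
definition stationary_increments :: "'a measure \<Rightarrow> real set \<Rightarrow> (real \<Rightarrow> 'a \<Rightarrow> real) \<Rightarrow> bool" where
  "stationary_increments M T X \<longleftrightarrow>
     (\<forall>s\<in>T. \<forall>t\<in>T. \<forall>J. finite J \<and> (\<forall>h\<in>J. 0 \<le> h \<and> s + h \<in> T \<and> t + h \<in> T) \<longrightarrow>
        distr M (\<Pi>\<^sub>M h\<in>J. borel) (\<lambda>\<omega>. \<lambda>h\<in>J. X (s + h) \<omega> - X s \<omega>) =
        distr M (\<Pi>\<^sub>M h\<in>J. borel) (\<lambda>\<omega>. \<lambda>h\<in>J. X (t + h) \<omega> - X t \<omega>))"

definition gmsi_process ::
  "'a measure \<Rightarrow> (real \<Rightarrow> 'a \<Rightarrow> real) \<Rightarrow> real \<Rightarrow> real \<Rightarrow> ereal \<Rightarrow> bool" where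
  "gmsi_process M X \<theta> \<tau> \<Delta> \<longleftrightarrow>
     (let T = time_interval \<Delta> in
       0 < \<Delta> \<and> 0 < \<theta> \<and> ereal \<tau> \<le> ereal \<theta> / \<Delta> \<and>
       prob_space M \<and>
       (\<forall>t\<in>T. X t \<in> borel_measurable M) \<and>
       (\<forall>\<omega>\<in>space M. continuous_on T (\<lambda>t. X t \<omega>)) \<and>
       (AE \<omega> in M. X 0 \<omega> = 0) \<and>
       (\<forall>t\<in>T. integral\<^sup>L M (X t) = 0) \<and>
       gaussian_process M T X \<and>
       markov_process M T X \<and>
       stationary_increments M T X \<and>
       (\<forall>s\<in>T. \<forall>t\<in>T. s \<le> t \<longrightarrow> integral\<^sup>L M (\<lambda>\<omega>. X s \<omega> * X t \<omega>) = s * (\<theta> - \<tau> * t)))"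

definition path_space :: "real set \<Rightarrow> (real \<Rightarrow> real) measure" where
  "path_space T = restrict_space (\<Pi>\<^sub>M t\<in>T. borel) {w. continuous_on T w}"

definition path_map :: "real set \<Rightarrow> (real \<Rightarrow> 'a \<Rightarrow> real) \<Rightarrow> 'a \<Rightarrow> real \<Rightarrow> real" where
  "path_map T Y \<omega> = (\<lambda>t\<in>T. Y t \<omega>)"

definition regular_conditional_law ::
  "'a measure \<Rightarrow> real set \<Rightarrow> (real \<Rightarrow> 'a \<Rightarrow> real) \<Rightarrow> ('a \<Rightarrow> 'v::topological_space) \<Rightarrow>
   ('v \<Rightarrow> (real \<Rightarrow> real) measure) \<Rightarrow> bool" where
  "regular_conditional_law M T Y V \<kappa> \<longleftrightarrow>
     \<kappa> \<in> measurable borel (prob_algebra (path_space T)) \<and>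
     (\<forall>A\<in>sets borel. \<forall>B\<in>sets (path_space T).
        emeasure M {\<omega>\<in>space M. V \<omega> \<in> A \<and> path_map T Y \<omega> \<in> B} =
        (\<integral>\<^sup>+v\<in>A. emeasure (\<kappa> v) B \<partial>distr M borel V))"

(* Regular conditional laws are determined only up to null sets of values v.  Weak continuity in v of
   the finite-dimensional distributions singles out the usual conditional law of a Gaussian process
   given a nondegenerate Gaussian vector, at every v.  These distributions are taken along sequences
   of times: on real sequences with the product topology, weak convergence is the same as weak
   convergence of all finite-dimensional marginals. *)
definition continuous_conditional_law ::
  "'a measure \<Rightarrow> real set \<Rightarrow> (real \<Rightarrow> 'a \<Rightarrow> real) \<Rightarrow> ('a \<Rightarrow> 'v::topological_space) \<Rightarrow>
   ('v \<Rightarrow> (real \<Rightarrow> real) measure) \<Rightarrow> bool" where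
  "continuous_conditional_law M T Y V \<kappa> \<longleftrightarrow>
     regular_conditional_law M T Y V \<kappa> \<and>
     (\<forall>(t :: nat \<Rightarrow> real) (g :: (nat \<Rightarrow> real) \<Rightarrow> real).
        range t \<subseteq> T \<and> continuous_on UNIV g \<and> bounded (range g) \<longrightarrow>
        continuous_on UNIV (\<lambda>v. \<integral>w. g (\<lambda>i. w (t i)) \<partial>\<kappa> v))"

end

(* Write c_i = 1 / (theta_i / tau_i - u) and let R_i(h) be X_i(u + h) - X_i(u) + h c_i X_i(u), the
   residual in the linear regression of the increment on X_i(u).  The X_i are jointly Gaussian, so
   Z = sum_i k_i R_i, being uncorrelated with V = (X_i(u))_i, is independent of V; as
   Y(h) = Z(h) + h a(V) with a(v) = sum_i k_i c_i (x_i - v_i), the law of Z + h a(v) is a conditional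
   law given V = v that is weakly continuous in v, and a(x) = 0.  Any other continuous conditional law
   agrees with it at x, since x lies in the support of the law of V and a law on paths is determined
   by its finite-dimensional characteristic functions (Cramer-Wold).  Finally the covariance of Z is
   s (theta - tau_u t), and for a centered Gaussian process such a covariance already forces
   stationary increments and, as X_t minus its regression on X_s is independent of the past of s, the
   Markov property. *)

theory Submission
  imports Defs
begin

section \<open>Joint laws and characteristic functions\<close>

text \<open>The constant c_i is forced: the covariance of X_i(u + h) - X_i(u) with X_i(u) is -h
  tau_i u, the variance of X_i(u) is u (theta_i - tau_i u), and the quotient is -h tau_i / (theta_i
  - tau_i u) = -h c_i. The factor u cancels, so the same c_i serves at u = 0, where V is almost
  surely 0 and 0 is the only point of its support. The residuals of one component have covariance h
  (theta_i - theta_i c_i h') for h <= h'; weighting with k_i^2 and summing gives theta and tau_u.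
  The obstacle is that independence of Z and V and uniqueness of conditional laws concern whole
  paths, that is, families over uncountable index sets. Both are reduced to characteristic functions
  of finite linear combinations, and these to the one-dimensional Levy uniqueness theorem: the other
  coordinates are carried along as a bounded weight. Independence of Z and V is expressed as an
  equation between a joint law and a product law.\<close>

lemma borel_measurable_cis [measurable]: "cis \<in> borel_measurable borel"
  by (intro borel_measurable_continuous_onI continuous_on_cis continuous_on_id)

lemma borel_measurable_cnj [measurable]: "cnj \<in> borel_measurable borel"
  by (intro borel_measurable_continuous_onI continuous_on_cnj continuous_on_id)

lemma prob_space_integrable_bounded:
  fixes f :: "'a \<Rightarrow> 'b::{real_normed_algebra_1, banach, second_countable_topology}"
  assumes "prob_space M" and [measurable]: "f \<in> borel_measurable M" and "\<And>\<omega>. norm (f \<omega>) \<le> C"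
  shows "integrable M f"
proof -
  interpret prob_space M by fact
  show ?thesis by (rule integrable_const_bound[where B = C]) (use assms in auto)
qed

text \<open>Normalizing the weight \<open>h\<close> by its total mass \<open>m\<close> makes it a
  probability density, so weighted expectations of functions of \<open>U\<close> become expectations
  under a genuine law \<open>N\<close>. This is how Levy's uniqueness theorem gets access to
  them.\<close>

lemma char_weighted_distr:
  fixes h U :: "'a \<Rightarrow> real"
  assumes M: "prob_space M" and [measurable]: "U \<in> borel_measurable M" "h \<in> borel_measurable M"
    and h: "\<And>\<omega>. 0 \<le> h \<omega>" "\<And>\<omega>. h \<omega> \<le> C" and hm: "m = (\<integral>\<omega>. h \<omega> \<partial>M)" and m0: "m > 0"
    and [measurable]: "A \<in> sets borel"
  defines "N \<equiv> distr (density M (\<lambda>\<omega>. ennreal (h \<omega> / m))) borel U"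
  shows "real_distribution N"
    and "char N s = (\<integral>\<omega>. h \<omega> * cis (s * U \<omega>) \<partial>M) / m"
    and "measure N A = (\<integral>\<omega>. h \<omega> * indicator A (U \<omega>) \<partial>M) / m"
proof -
  interpret prob_space M by fact
  let ?D = "density M (\<lambda>\<omega>. ennreal (h \<omega> / m))"
  have int: "integrable M h"
    by (rule integrable_const_bound[where B = C]) (use h in auto)
  have "emeasure ?D (space ?D) = (\<integral>\<^sup>+\<omega>. ennreal (h \<omega> / m) \<partial>M)"
    by (simp add: emeasure_density cong: nn_integral_cong)
  also have "\<dots> = ennreal (\<integral>\<omega>. h \<omega> / m \<partial>M)"
    using int h m0 by (intro nn_integral_eq_integral) auto
  also have "(\<integral>\<omega>. h \<omega> / m \<partial>M) = 1" using hm m0 by simp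
  finally interpret D: prob_space ?D
    by (intro prob_spaceI) simp
  show "real_distribution N"
    unfolding N_def by (rule D.real_distribution_distr) simp
  have "char N s = (\<integral>\<omega>. (h \<omega> / m) *\<^sub>R cis (s * U \<omega>) \<partial>M)"
    using h m0 unfolding char_def N_def cis_conv_exp[symmetric]
    by (subst integral_distr; simp add: integral_density)
  also have "\<dots> = (\<integral>\<omega>. (h \<omega> * cis (s * U \<omega>)) / m \<partial>M)"
    by (simp add: scaleR_conv_of_real)
  finally show "char N s = (\<integral>\<omega>. h \<omega> * cis (s * U \<omega>) \<partial>M) / m" by simp
  have "measure N A = (\<integral>x. indicator A x \<partial>N)"
    by (simp add: N_def)
  also have "\<dots> = (\<integral>\<omega>. (h \<omega> / m) *\<^sub>R indicator A (U \<omega>) \<partial>M)"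
    using h m0 unfolding N_def by (subst integral_distr; simp add: integral_density)
  also have "\<dots> = (\<integral>\<omega>. h \<omega> * indicator A (U \<omega>) \<partial>M) / m"
    by simp
  finally show "measure N A = (\<integral>\<omega>. h \<omega> * indicator A (U \<omega>) \<partial>M) / m" .
qed

text \<open>At frequency 0 the hypothesis \<open>ch\<close> says that both weights have the same
  mass, so they are normalized by the same constant and the two image laws have equal characteristic
  functions.\<close>

lemma weighted_law_unique_nonneg:
  fixes g W :: "'a \<Rightarrow> real" and g' W' :: "'b \<Rightarrow> real"
  assumes M: "prob_space M" "prob_space M'"
    and m: "W \<in> borel_measurable M" "W' \<in> borel_measurable M'"
      "g \<in> borel_measurable M" "g' \<in> borel_measurable M'"
    and bd: "\<And>\<omega>. 0 \<le> g \<omega>" "\<And>\<omega>. g \<omega> \<le> C" "\<And>\<omega>. 0 \<le> g' \<omega>" "\<And>\<omega>. g' \<omega> \<le> C"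
    and pos: "(\<integral>\<omega>. g \<omega> \<partial>M) > 0"
    and ch: "\<And>s. (\<integral>\<omega>. g \<omega> * cis (s * W \<omega>) \<partial>M) = (\<integral>\<omega>. g' \<omega> * cis (s * W' \<omega>) \<partial>M')"
    and A: "A \<in> sets borel"
  shows "(\<integral>\<omega>. g \<omega> * indicator A (W \<omega>) \<partial>M) = (\<integral>\<omega>. g' \<omega> * indicator A (W' \<omega>) \<partial>M')"
proof -
  define m where "m = (\<integral>\<omega>. g \<omega> \<partial>M)"
  have "complex_of_real (\<integral>\<omega>. g \<omega> \<partial>M) = complex_of_real (\<integral>\<omega>. g' \<omega> \<partial>M')"
    using ch[of 0] by simp
  then have m': "m = (\<integral>\<omega>. g' \<omega> \<partial>M')"
    unfolding m_def by (simp only: of_real_eq_iff)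
  have m0: "m > 0" using pos by (simp add: m_def)
  note k1 = char_weighted_distr[OF M(1) m(1,3) bd(1,2) m_def m0 A]
  note k2 = char_weighted_distr[OF M(2) m(2,4) bd(3,4) m' m0 A]
  have "distr (density M (\<lambda>\<omega>. ennreal (g \<omega> / m))) borel W = distr (density M' (\<lambda>\<omega>. ennreal (g' \<omega> / m))) borel W'"
    by (intro Levy_uniqueness k1(1) k2(1)) (simp add: fun_eq_iff k1(2) k2(2) ch)
  then show ?thesis using k1(3) k2(3) m0 by simp
qed

text \<open>Adding 2 to a weight bounded by 1 makes it a positive density, to which Levy's theorem applies.\<close>

lemma weighted_law_unique_real:
  fixes f W :: "'a \<Rightarrow> real" and f' W' :: "'b \<Rightarrow> real"
  assumes M: "prob_space M" "prob_space M'"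
    and [measurable]: "W \<in> borel_measurable M" "W' \<in> borel_measurable M'"
      "f \<in> borel_measurable M" "f' \<in> borel_measurable M'"
    and bd: "\<And>\<omega>. \<bar>f \<omega>\<bar> \<le> 1" "\<And>\<omega>. \<bar>f' \<omega>\<bar> \<le> 1"
    and ch1: "\<And>s. (\<integral>\<omega>. cis (s * W \<omega>) \<partial>M) = (\<integral>\<omega>. cis (s * W' \<omega>) \<partial>M')"
    and ch: "\<And>s. (\<integral>\<omega>. f \<omega> * cis (s * W \<omega>) \<partial>M) = (\<integral>\<omega>. f' \<omega> * cis (s * W' \<omega>) \<partial>M')"
    and [measurable]: "A \<in> sets borel"
  shows "(\<integral>\<omega>. f \<omega> * indicator A (W \<omega>) \<partial>M) = (\<integral>\<omega>. f' \<omega> * indicator A (W' \<omega>) \<partial>M')"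
proof -
  interpret M: prob_space M by fact
  interpret M': prob_space M' by fact
  note I = prob_space_integrable_bounded[OF M(1), where C = 1] prob_space_integrable_bounded[OF M(2), where C = 1]
  have i: "integrable M f" "integrable M' f'" using bd by (auto intro!: I)
  have ic: "integrable M (\<lambda>\<omega>. cis (s * W \<omega>))" "integrable M' (\<lambda>\<omega>. cis (s * W' \<omega>))"
    "integrable M (\<lambda>\<omega>. f \<omega> * cis (s * W \<omega>))" "integrable M' (\<lambda>\<omega>. f' \<omega> * cis (s * W' \<omega>))" for s
    by (auto intro!: I simp: norm_mult bd)
  have ii: "integrable M (\<lambda>\<omega>. indicator A (W \<omega>) :: real)" "integrable M' (\<lambda>\<omega>. indicator A (W' \<omega>) :: real)"
    "integrable M (\<lambda>\<omega>. f \<omega> * indicator A (W \<omega>))" "integrable M' (\<lambda>\<omega>. f' \<omega> * indicator A (W' \<omega>))"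
    using bd by (auto intro!: I simp: abs_mult indicator_def)
  \<comment> \<open>The mean of \<open>f\<close> is at least -1, so the shifted weight has mass at
    least 1.\<close>
  have "(\<integral>\<omega>. -1 \<partial>M) \<le> (\<integral>\<omega>. f \<omega> \<partial>M)"
    using bd(1) i by (intro integral_mono) (auto simp: abs_le_iff minus_le_iff)
  then have pos: "0 < (\<integral>\<omega>. 2 + f \<omega> \<partial>M)"
    using i by (simp add: M.prob_space)
  have b: "0 \<le> 2 + f \<omega>" "2 + f \<omega> \<le> 3" for \<omega> using bd(1)[of \<omega>] by auto
  have b': "0 \<le> 2 + f' \<omega>" "2 + f' \<omega> \<le> 3" for \<omega> using bd(2)[of \<omega>] by auto
  \<comment> \<open>Weight 1 identifies the plain laws of \<open>W\<close> and \<open>W'\<close>;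
    twice this is subtracted at the end to undo the shift by 2.\<close>
  have one: "(\<integral>\<omega>. 1 * indicator A (W \<omega>) \<partial>M) = (\<integral>\<omega>. (1::real) * indicator A (W' \<omega>) \<partial>M')"
    by (rule weighted_law_unique_nonneg[OF M, where C = 1]) (simp_all add: M.prob_space ch1)
  have "(\<integral>\<omega>. (2 + f \<omega>) * indicator A (W \<omega>) \<partial>M) = (\<integral>\<omega>. (2 + f' \<omega>) * indicator A (W' \<omega>) \<partial>M')"
  proof (rule weighted_law_unique_nonneg[OF M _ _ _ _ b b' pos])
    show "(\<integral>\<omega>. complex_of_real (2 + f \<omega>) * cis (s * W \<omega>) \<partial>M) = (\<integral>\<omega>. complex_of_real (2 + f' \<omega>) * cis (s * W' \<omega>) \<partial>M')" for s
      using ic[of s] ch1[of s] ch[of s] by (simp add: distrib_right)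
  qed auto
  then show ?thesis
    using ii one by (simp add: distrib_right)
qed

text \<open>Conjugating the weight amounts to reflecting the frequency, so agreement at all
  frequencies passes to the conjugate weights.\<close>

lemma integral_cnj_mult_cis:
  "(\<integral>\<omega>. cnj (h \<omega>) * cis (s * V \<omega>) \<partial>N) = cnj (\<integral>\<omega>. h \<omega> * cis (- s * V \<omega>) \<partial>N)"
proof -
  have "cnj (h \<omega>) * cis (s * V \<omega>) = cnj (h \<omega> * cis (- s * V \<omega>))" for \<omega>
    by (simp add: cis_cnj)
  then show ?thesis by (simp only: Bochner_Integration.integral_cnj)
qed

lemma Re_Im_mult_indicator:
  "Re (z * indicator A x) = Re z * indicator A x" "Im (z * indicator A x) = Im z * indicator A x"
  by (simp_all add: indicator_def)

text \<open>Real and imaginary parts are combinations of the weight and its conjugate, and the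
  conjugates have equal transforms because \<open>ch\<close> also covers -s. Complex weights are
  wanted because other coordinates will enter them through factors \<open>cis\<close>.\<close>

lemma weighted_law_unique:
  fixes W :: "'a \<Rightarrow> real" and W' :: "'b \<Rightarrow> real" and f :: "'a \<Rightarrow> complex" and f' :: "'b \<Rightarrow> complex"
  assumes M: "prob_space M" "prob_space M'"
    and [measurable]: "W \<in> borel_measurable M" "W' \<in> borel_measurable M'"
      "f \<in> borel_measurable M" "f' \<in> borel_measurable M'"
    and bd: "\<And>\<omega>. norm (f \<omega>) \<le> 1" "\<And>\<omega>. norm (f' \<omega>) \<le> 1"
    and ch1: "\<And>s. (\<integral>\<omega>. cis (s * W \<omega>) \<partial>M) = (\<integral>\<omega>. cis (s * W' \<omega>) \<partial>M')"
    and ch: "\<And>s. (\<integral>\<omega>. f \<omega> * cis (s * W \<omega>) \<partial>M) = (\<integral>\<omega>. f' \<omega> * cis (s * W' \<omega>) \<partial>M')"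
    and A[measurable]: "A \<in> sets borel"
  shows "(\<integral>\<omega>. f \<omega> * indicator A (W \<omega>) \<partial>M) = (\<integral>\<omega>. f' \<omega> * indicator A (W' \<omega>) \<partial>M')"
proof -
  note I = prob_space_integrable_bounded[OF M(1), where C = 1] prob_space_integrable_bounded[OF M(2), where C = 1]
  have i: "integrable M (\<lambda>\<omega>. f \<omega> * cis (s * W \<omega>))" "integrable M' (\<lambda>\<omega>. f' \<omega> * cis (s * W' \<omega>))" 
   "integrable M (\<lambda>\<omega>. cnj (f \<omega>) * cis (s * W \<omega>))" "integrable M' (\<lambda>\<omega>. cnj (f' \<omega>) * cis (s * W' \<omega>))" for s
    by (auto intro!: I simp: norm_mult bd)
  have cc: "(\<integral>\<omega>. cnj (f \<omega>) * cis (s * W \<omega>) \<partial>M) = (\<integral>\<omega>. cnj (f' \<omega>) * cis (s * W' \<omega>) \<partial>M')" for s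
    using ch[of "-s"] by (simp add: integral_cnj_mult_cis)
  have re: "complex_of_real (Re z) = (z + cnj z) / 2" and im: "complex_of_real (Im z) = (z - cnj z) / (2 * \<i>)" for z
    by (simp_all add: complex_eq_iff)
  have "(\<integral>\<omega>. Re (f \<omega>) * indicator A (W \<omega>) \<partial>M) = (\<integral>\<omega>. Re (f' \<omega>) * indicator A (W' \<omega>) \<partial>M')"
  proof (rule weighted_law_unique_real[OF M _ _ _ _ _ _ ch1])
    show "(\<integral>\<omega>. complex_of_real (Re (f \<omega>)) * cis (s * W \<omega>) \<partial>M) = (\<integral>\<omega>. complex_of_real (Re (f' \<omega>)) * cis (s * W' \<omega>) \<partial>M')" for s
      unfolding re times_divide_eq_left distrib_right using i[of s] ch[of s] cc[of s] by simp
  qed (use bd abs_Re_le_cmod order_trans in \<open>auto, blast+\<close>)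
  moreover have "(\<integral>\<omega>. Im (f \<omega>) * indicator A (W \<omega>) \<partial>M) = (\<integral>\<omega>. Im (f' \<omega>) * indicator A (W' \<omega>) \<partial>M')"
  proof (rule weighted_law_unique_real[OF M _ _ _ _ _ _ ch1])
    show "(\<integral>\<omega>. complex_of_real (Im (f \<omega>)) * cis (s * W \<omega>) \<partial>M) = (\<integral>\<omega>. complex_of_real (Im (f' \<omega>)) * cis (s * W' \<omega>) \<partial>M')" for s
      unfolding im times_divide_eq_left left_diff_distrib using i[of s] ch[of s] cc[of s] by simp
  qed (use bd abs_Im_le_cmod order_trans in \<open>auto, blast+\<close>)
  moreover have "integrable M (\<lambda>\<omega>. f \<omega> * indicator A (W \<omega>))" "integrable M' (\<lambda>\<omega>. f' \<omega> * indicator A (W' \<omega>))"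
    using bd by (auto intro!: I simp: norm_mult indicator_def)
  ultimately show ?thesis
    by (simp add: complex_eq_iff integral_Re[symmetric] integral_Im[symmetric] Re_Im_mult_indicator
      del: times_complex.sel)
qed

text \<open>Frequencies are traded for indicators one coordinate at a time.\<close>

lemma cylinder_weight_eq:
  fixes W :: "'i \<Rightarrow> 'a \<Rightarrow> real" and W' :: "'i \<Rightarrow> 'b \<Rightarrow> real"
  assumes M: "prob_space M" "prob_space M'"
    and m: "\<And>i. i \<in> I \<Longrightarrow> W i \<in> borel_measurable M" "\<And>i. i \<in> I \<Longrightarrow> W' i \<in> borel_measurable M'"
    and ch: "\<And>J c. finite J \<Longrightarrow> J \<subseteq> I \<Longrightarrow>
      (\<integral>\<omega>. cis (\<Sum>j\<in>J. c j * W j \<omega>) \<partial>M) = (\<integral>\<omega>. cis (\<Sum>j\<in>J. c j * W' j \<omega>) \<partial>M')"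
    and K: "finite K" "finite R" "K \<inter> R = {}" "K \<subseteq> I" "R \<subseteq> I"
    and A: "\<And>j. j \<in> K \<Longrightarrow> A j \<in> sets borel"
  shows "(\<integral>\<omega>. cis (\<Sum>j\<in>R. c j * W j \<omega>) * (\<Prod>j\<in>K. indicator (A j) (W j \<omega>)) \<partial>M) =
         (\<integral>\<omega>. cis (\<Sum>j\<in>R. c j * W' j \<omega>) * (\<Prod>j\<in>K. indicator (A j) (W' j \<omega>)) \<partial>M')"
  using K A
proof (induction K arbitrary: R c rule: finite_induct)
  case empty
  then show ?case using ch by simp
next
  case (insert a K)
  have a: "a \<in> I" "a \<notin> R" "A a \<in> sets borel" using insert by auto
  have mR: "W j \<in> borel_measurable M" "W' j \<in> borel_measurable M'" if "j \<in> R" for j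
    using m that insert.prems by auto
  have mK: "(\<lambda>\<omega>. indicator (A j) (W j \<omega>) :: complex) \<in> borel_measurable M"
      "(\<lambda>\<omega>. indicator (A j) (W' j \<omega>) :: complex) \<in> borel_measurable M'" if "j \<in> K" for j
  proof -
    have [measurable]: "W j \<in> borel_measurable M" "W' j \<in> borel_measurable M'" "A j \<in> sets borel"
      using m that insert.prems by auto
    show "(\<lambda>\<omega>. indicator (A j) (W j \<omega>) :: complex) \<in> borel_measurable M"
      "(\<lambda>\<omega>. indicator (A j) (W' j \<omega>) :: complex) \<in> borel_measurable M'" by measurable
  qed
  define f where "f \<omega> = cis (\<Sum>j\<in>R. c j * W j \<omega>) * (\<Prod>j\<in>K. indicator (A j) (W j \<omega>))" for \<omega>
  define f' where "f' \<omega> = cis (\<Sum>j\<in>R. c j * W' j \<omega>) * (\<Prod>j\<in>K. indicator (A j) (W' j \<omega>))" for \<omega>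
  have bd: "norm (f \<omega>) \<le> 1" "norm (f' \<omega>') \<le> 1" for \<omega> \<omega>'
    by (auto simp: f_def f'_def norm_mult prod_norm[symmetric] indicator_def intro!: prod_le_1)
  \<comment> \<open>Everything except coordinate \<open>a\<close> is collected in a weight of
    modulus at most 1.\<close>
  have "(\<integral>\<omega>. f \<omega> * indicator (A a) (W a \<omega>) \<partial>M) = (\<integral>\<omega>. f' \<omega> * indicator (A a) (W' a \<omega>) \<partial>M')"
  proof (rule weighted_law_unique[OF M _ _ _ _ bd])
    show "f \<in> borel_measurable M" "f' \<in> borel_measurable M'"
      unfolding f_def f'_def using mR mK by measurable
    show "(\<integral>\<omega>. cis (s * W a \<omega>) \<partial>M) = (\<integral>\<omega>. cis (s * W' a \<omega>) \<partial>M')" for s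
      using ch[of "{a}" "\<lambda>_. s"] a by simp
    show "(\<integral>\<omega>. f \<omega> * cis (s * W a \<omega>) \<partial>M) = (\<integral>\<omega>. f' \<omega> * cis (s * W' a \<omega>) \<partial>M')" for s
    proof -
      \<comment> \<open>The factor \<open>cis (s * W a \<omega>)\<close> is absorbed by adding
        \<open>a\<close> to the frequencies \<open>R\<close>; this is why the induction generalizes
        \<open>R\<close> and \<open>c\<close>.\<close>
      have e: "(\<Sum>j\<in>insert a R. (c(a := s)) j * V j) = s * V a + (\<Sum>j\<in>R. c j * V j)" for V :: "'i \<Rightarrow> real"
        using a insert.prems by (simp, intro sum.cong, auto)
      show ?thesis
        using insert.IH[of "insert a R" "c(a := s)"] insert.prems insert.hyps a
        unfolding e by (simp add: f_def f'_def cis_mult[symmetric] mult_ac)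
    qed
  qed (use m a in auto)
  then show ?case
    using insert.hyps by (simp add: f_def f'_def mult_ac)
qed

lemma restrict_vimage_prod_emb:
  assumes "J \<subseteq> I"
  shows "(\<lambda>\<omega>. \<lambda>i\<in>I. V i \<omega>) -` prod_emb I (\<lambda>_. borel) J (Pi\<^sub>E J A) \<inter> S = {\<omega>\<in>S. \<forall>j\<in>J. V j \<omega> \<in> A j}"
  using assms by (auto simp: prod_emb_def PiE_iff subset_iff)

lemma integral_prod_indicator:
  assumes "finite J" and S: "{\<omega>\<in>space M. \<forall>j\<in>J. W j \<omega> \<in> A j} \<in> sets M"
  shows "(\<integral>\<omega>. (\<Prod>j\<in>J. indicator (A j) (W j \<omega>)) \<partial>M) =
    complex_of_real (measure M {\<omega>\<in>space M. \<forall>j\<in>J. W j \<omega> \<in> A j})"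
proof -
  have "(\<integral>\<omega>. (\<Prod>j\<in>J. indicator (A j) (W j \<omega>)) \<partial>M) =
      (\<integral>\<omega>. complex_of_real (indicator {\<omega>\<in>space M. \<forall>j\<in>J. W j \<omega> \<in> A j} \<omega>) \<partial>M)"
    using assms(1) by (intro Bochner_Integration.integral_cong) (auto simp: indicator_def prod_zero_iff)
  also have "\<dots> = complex_of_real (measure M {\<omega>\<in>space M. \<forall>j\<in>J. W j \<omega> \<in> A j})"
    using S by (simp add: integral_complex_of_real del: of_real_indicator)
  finally show ?thesis .
qed

text \<open>\<open>I\<close> may be infinite: a finite measure on the product is determined by
  cylinders over finite \<open>J\<close>. Their probabilities are integrals of products of
  indicators, the case of \<open>cylinder_weight_eq\<close> with no frequency left.\<close>

lemma cramer_wold: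
  fixes W :: "'i \<Rightarrow> 'a \<Rightarrow> real" and W' :: "'i \<Rightarrow> 'b \<Rightarrow> real"
  assumes M: "prob_space M" "prob_space M'"
    and m: "\<And>i. i \<in> I \<Longrightarrow> W i \<in> borel_measurable M" "\<And>i. i \<in> I \<Longrightarrow> W' i \<in> borel_measurable M'"
    and ch: "\<And>J c. finite J \<Longrightarrow> J \<subseteq> I \<Longrightarrow>
      (\<integral>\<omega>. cis (\<Sum>j\<in>J. c j * W j \<omega>) \<partial>M) = (\<integral>\<omega>. cis (\<Sum>j\<in>J. c j * W' j \<omega>) \<partial>M')"
  shows "distr M (\<Pi>\<^sub>M i\<in>I. borel) (\<lambda>\<omega>. \<lambda>i\<in>I. W i \<omega>) = distr M' (\<Pi>\<^sub>M i\<in>I. borel) (\<lambda>\<omega>. \<lambda>i\<in>I. W' i \<omega>)"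
proof (rule measure_eqI_PiM_infinite)
  interpret M: prob_space M by fact
  interpret M': prob_space M' by fact
  have mm: "(\<lambda>\<omega>. \<lambda>i\<in>I. W i \<omega>) \<in> measurable M (\<Pi>\<^sub>M i\<in>I. borel)" "(\<lambda>\<omega>. \<lambda>i\<in>I. W' i \<omega>) \<in> measurable M' (\<Pi>\<^sub>M i\<in>I. borel)"
    using m by (auto intro!: measurable_restrict)
  show "finite_measure (distr M (\<Pi>\<^sub>M i\<in>I. borel) (\<lambda>\<omega>. \<lambda>i\<in>I. W i \<omega>))"
    using mm by (intro prob_space.finite_measure M.prob_space_distr)
  fix A :: "'i \<Rightarrow> real set" and J
  assume J: "finite J" "J \<subseteq> I" "\<And>i. i \<in> J \<Longrightarrow> A i \<in> sets borel"
  have S: "{\<omega>\<in>space M. \<forall>j\<in>J. W j \<omega> \<in> A j} \<in> sets M" "{\<omega>\<in>space M'. \<forall>j\<in>J. W' j \<omega> \<in> A j} \<in> sets M'"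
    using J m by (auto intro!: sets.sets_Collect_finite_All' measurable_sets_Collect[where N = borel] simp: subset_iff)
  have pe: "prod_emb I (\<lambda>_. borel) J (Pi\<^sub>E J A) \<in> sets (\<Pi>\<^sub>M i\<in>I. borel)"
    using J by (intro sets_PiM_I) auto
  note v = restrict_vimage_prod_emb[OF J(2)]
  have "(\<integral>\<omega>. cis (\<Sum>j\<in>{}. 0 * W j \<omega>) * (\<Prod>j\<in>J. indicator (A j) (W j \<omega>)) \<partial>M) =
        (\<integral>\<omega>. cis (\<Sum>j\<in>{}. 0 * W' j \<omega>) * (\<Prod>j\<in>J. indicator (A j) (W' j \<omega>)) \<partial>M')"
    by (rule cylinder_weight_eq[OF M m ch]) (use J in auto)
  then have "complex_of_real (measure M {\<omega>\<in>space M. \<forall>j\<in>J. W j \<omega> \<in> A j}) = measure M' {\<omega>\<in>space M'. \<forall>j\<in>J. W' j \<omega> \<in> A j}"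
    by (simp add: integral_prod_indicator[OF J(1) S(1)] integral_prod_indicator[OF J(1) S(2)])
  then have "emeasure M {\<omega>\<in>space M. \<forall>j\<in>J. W j \<omega> \<in> A j} = emeasure M' {\<omega>\<in>space M'. \<forall>j\<in>J. W' j \<omega> \<in> A j}"
    by (simp only: of_real_eq_iff M.emeasure_eq_measure M'.emeasure_eq_measure)
  then show "emeasure (distr M (\<Pi>\<^sub>M i\<in>I. borel) (\<lambda>\<omega>. \<lambda>i\<in>I. W i \<omega>)) (prod_emb I (\<lambda>_. borel) J (Pi\<^sub>E J A)) =
    emeasure (distr M' (\<Pi>\<^sub>M i\<in>I. borel) (\<lambda>\<omega>. \<lambda>i\<in>I. W' i \<omega>)) (prod_emb I (\<lambda>_. borel) J (Pi\<^sub>E J A))"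
    using mm pe by (simp add: emeasure_distr v)
qed simp_all

section \<open>Spaces of centered Gaussian variables\<close>

text \<open>A linear space of centered variables, jointly Gaussian because every linear combination
  is again a member. Together with the zero function the one operation \<open>f + a * g\<close>
  yields both sums and multiples. Closure in mean square is not demanded.\<close>

definition gaussian_space :: "'a measure \<Rightarrow> ('a \<Rightarrow> real) set \<Rightarrow> bool" where
  "gaussian_space M G \<longleftrightarrow> prob_space M \<and> (\<lambda>_. 0) \<in> G \<and>
     (\<forall>f\<in>G. gaussian_rv M f \<and> integral\<^sup>L M f = 0) \<and>
     (\<forall>f\<in>G. \<forall>g\<in>G. \<forall>a. (\<lambda>\<omega>. f \<omega> + a * g \<omega>) \<in> G)"

text \<open>Mean zero forces a point mass to sit at 0 and a normal law to have
  \<open>\<mu> = 0\<close>, so one formula in terms of the variance covers both.\<close>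

lemma centered_gaussian_rv:
  assumes M: "prob_space M" and g: "gaussian_rv M f" and mean: "integral\<^sup>L M f = 0"
  shows "integrable M f" "integrable M (\<lambda>\<omega>. (f \<omega>)\<^sup>2)"
    and "(\<integral>\<omega>. cis (f \<omega>) \<partial>M) = exp (- (\<integral>\<omega>. (f \<omega>)\<^sup>2 \<partial>M) / 2)"
proof -
  interpret prob_space M by fact
  have [measurable]: "f \<in> borel_measurable M" using g by (simp add: gaussian_rv_def)
  consider (const) \<mu> where "AE \<omega> in M. f \<omega> = \<mu>"
    | (normal) \<mu> \<sigma> where "\<sigma> > 0" "distributed M lborel f (\<lambda>z. ennreal (normal_density \<mu> \<sigma> z))"
    using g unfolding gaussian_rv_def by blast
  then have "integrable M f \<and> integrable M (\<lambda>\<omega>. (f \<omega>)\<^sup>2) \<and>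
    (\<integral>\<omega>. cis (f \<omega>) \<partial>M) = exp (- (\<integral>\<omega>. (f \<omega>)\<^sup>2 \<partial>M) / 2)"
  proof cases
    case const
    have "integral\<^sup>L M f = (\<integral>\<omega>. \<mu> \<partial>M)" by (rule integral_cong_AE) (use const in auto)
    then have ae: "AE \<omega> in M. f \<omega> = 0" using mean const by (simp add: prob_space)
    have "integrable M f \<longleftrightarrow> integrable M (\<lambda>\<omega>. 0::real)"
      by (rule integrable_cong_AE) (use ae in auto)
    moreover have "integrable M (\<lambda>\<omega>. (f \<omega>)\<^sup>2) \<longleftrightarrow> integrable M (\<lambda>\<omega>. 0::real)"
      by (rule integrable_cong_AE) (use ae in auto)
    moreover have "(\<integral>\<omega>. (f \<omega>)\<^sup>2 \<partial>M) = (\<integral>\<omega>. 0 \<partial>M)"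
      by (rule integral_cong_AE) (use ae in auto)
    moreover have "(\<integral>\<omega>. cis (f \<omega>) \<partial>M) = (\<integral>\<omega>. 1 \<partial>M)"
      by (rule integral_cong_AE) (use ae in auto)
    ultimately show ?thesis by (simp add: prob_space)
  next
    case normal
    note D = normal(2)
    have "\<mu> = integral\<^sup>L M f"
      using distributed_integral[OF D, of "\<lambda>x. x"] integral_normal_moment_nz_1[OF normal(1), of \<mu>] by simp
    then have \<mu>: "\<mu> = 0" using mean by simp
    have 1: "integrable M f"
      using distributed_integrable[OF D, of "\<lambda>x. x"] integrable_normal_moment_nz_1[OF normal(1), of \<mu>] by simp
    have 2: "integrable M (\<lambda>\<omega>. (f \<omega>)\<^sup>2)"
      using distributed_integrable[OF D, of "\<lambda>x. x\<^sup>2"] integrable_normal_moment[OF normal(1), of \<mu> 2] \<mu> by simp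
    have 3: "(\<integral>\<omega>. (f \<omega>)\<^sup>2 \<partial>M) = \<sigma>\<^sup>2"
      using distributed_integral[OF D, of "\<lambda>x. x\<^sup>2"] integral_normal_moment_even[OF normal(1), of \<mu> 1] \<mu>
      by (simp add: fact_numeral)
    \<comment> \<open>Dividing by \<open>\<sigma>\<close> gives a standard normal variable, whose
      characteristic function is then read off at \<open>\<sigma>\<close>.\<close>
    have "distributed M lborel (\<lambda>\<omega>. f \<omega> / \<sigma>) std_normal_density"
      using D normal_standard_normal_convert[OF normal(1), of f \<mu>] \<mu> by simp
    then have "distr M borel (\<lambda>\<omega>. f \<omega> / \<sigma>) = std_normal_distribution"
      by (simp add: distributed_def cong: distr_cong)
    then have "char (distr M borel (\<lambda>\<omega>. f \<omega> / \<sigma>)) \<sigma> = exp (- \<sigma>\<^sup>2 / 2)"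
      by (simp add: char_std_normal_distribution)
    moreover have "char (distr M borel (\<lambda>\<omega>. f \<omega> / \<sigma>)) \<sigma> = (\<integral>\<omega>. cis (f \<omega>) \<partial>M)"
      using normal(1) by (simp add: char_def integral_distr flip: cis_conv_exp)
    ultimately show ?thesis using 1 2 3 by simp
  qed
  then show "integrable M f" "integrable M (\<lambda>\<omega>. (f \<omega>)\<^sup>2)"
    "(\<integral>\<omega>. cis (f \<omega>) \<partial>M) = exp (- (\<integral>\<omega>. (f \<omega>)\<^sup>2 \<partial>M) / 2)" by blast+
qed

context
  fixes M :: "'a measure" and G
  assumes G: "gaussian_space M G"
begin

lemma gaussian_space_prob: "prob_space M"
  using G by (simp add: gaussian_space_def)

lemma gaussian_space_measurable: "f \<in> G \<Longrightarrow> f \<in> borel_measurable M"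
  using G by (simp add: gaussian_space_def gaussian_rv_def)

lemma gaussian_space_add: "f \<in> G \<Longrightarrow> g \<in> G \<Longrightarrow> (\<lambda>\<omega>. f \<omega> + a * g \<omega>) \<in> G"
  using G by (simp add: gaussian_space_def)

lemma gaussian_space_sum:
  assumes "finite J" "\<And>j. j \<in> J \<Longrightarrow> W j \<in> G"
  shows "(\<lambda>\<omega>. \<Sum>j\<in>J. c j * W j \<omega>) \<in> G"
  using assms
proof (induction J rule: finite_induct)
  case empty
  then show ?case using G by (simp add: gaussian_space_def)
next
  case (insert a J)
  then show ?case using gaussian_space_add[of "\<lambda>\<omega>. \<Sum>j\<in>J. c j * W j \<omega>" "W a" "c a"]
    by (simp add: add.commute)
qed

lemma gaussian_space_integrable:
  assumes "f \<in> G"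
  shows "integrable M f" "integrable M (\<lambda>\<omega>. (f \<omega>)\<^sup>2)"
    "(\<integral>\<omega>. cis (f \<omega>) \<partial>M) = exp (- (\<integral>\<omega>. (f \<omega>)\<^sup>2 \<partial>M) / 2)"
  using centered_gaussian_rv[of M f] assms G by (simp_all add: gaussian_space_def)

text \<open>Polarization: the product is a combination of squares of members of the space.\<close>

lemma gaussian_space_integrable_mult:
  assumes "f \<in> G" "g \<in> G"
  shows "integrable M (\<lambda>\<omega>. f \<omega> * g \<omega>)"
proof -
  have "integrable M (\<lambda>\<omega>. ((f \<omega> + 1 * g \<omega>)\<^sup>2 - (f \<omega>)\<^sup>2 - (g \<omega>)\<^sup>2) / 2)"
    using assms gaussian_space_add[of f g 1]
    by (intro integrable_divide_zero Bochner_Integration.integrable_diff gaussian_space_integrable) auto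
  also have "(\<lambda>\<omega>. ((f \<omega> + 1 * g \<omega>)\<^sup>2 - (f \<omega>)\<^sup>2 - (g \<omega>)\<^sup>2) / 2) = (\<lambda>\<omega>. f \<omega> * g \<omega>)"
    by (simp add: power2_eq_square algebra_simps)
  finally show ?thesis .
qed

lemma gaussian_space_integral_sum_mult_sum:
  assumes "finite J" "finite L" "\<And>j. j \<in> J \<Longrightarrow> W j \<in> G" "\<And>l. l \<in> L \<Longrightarrow> U l \<in> G"
  shows "(\<integral>\<omega>. (\<Sum>j\<in>J. c j * W j \<omega>) * (\<Sum>l\<in>L. d l * U l \<omega>) \<partial>M) =
    (\<Sum>j\<in>J. \<Sum>l\<in>L. c j * d l * (\<integral>\<omega>. W j \<omega> * U l \<omega> \<partial>M))"
proof -
  have "(\<integral>\<omega>. (\<Sum>j\<in>J. c j * W j \<omega>) * (\<Sum>l\<in>L. d l * U l \<omega>) \<partial>M) =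
      (\<integral>\<omega>. (\<Sum>j\<in>J. \<Sum>l\<in>L. (c j * d l) * (W j \<omega> * U l \<omega>)) \<partial>M)"
    by (simp add: sum_product mult_ac)
  also have "\<dots> = (\<Sum>j\<in>J. \<Sum>l\<in>L. c j * d l * (\<integral>\<omega>. W j \<omega> * U l \<omega> \<partial>M))"
    using assms by (simp add: Bochner_Integration.integral_sum gaussian_space_integrable_mult)
  finally show ?thesis .
qed

end

text \<open>The characteristic function of a linear combination depends only on its variance, which
  is a quadratic form in the covariances.\<close>

lemma gaussian_law_unique:
  fixes W :: "'i \<Rightarrow> 'a \<Rightarrow> real" and W' :: "'i \<Rightarrow> 'b \<Rightarrow> real"
  assumes G: "gaussian_space M G" "gaussian_space M' G'"
    and W: "\<And>i. i \<in> I \<Longrightarrow> W i \<in> G" "\<And>i. i \<in> I \<Longrightarrow> W' i \<in> G'"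
    and cov: "\<And>i j. i \<in> I \<Longrightarrow> j \<in> I \<Longrightarrow> (\<integral>\<omega>. W i \<omega> * W j \<omega> \<partial>M) = (\<integral>\<omega>. W' i \<omega> * W' j \<omega> \<partial>M')"
  shows "distr M (\<Pi>\<^sub>M i\<in>I. borel) (\<lambda>\<omega>. \<lambda>i\<in>I. W i \<omega>) = distr M' (\<Pi>\<^sub>M i\<in>I. borel) (\<lambda>\<omega>. \<lambda>i\<in>I. W' i \<omega>)"
proof (rule cramer_wold)
  fix J c assume J: "finite J" "J \<subseteq> I"
  then have m: "\<And>j. j \<in> J \<Longrightarrow> W j \<in> G" "\<And>j. j \<in> J \<Longrightarrow> W' j \<in> G'" using W by auto
  have "(\<integral>\<omega>. (\<Sum>j\<in>J. c j * W j \<omega>)\<^sup>2 \<partial>M) = (\<integral>\<omega>. (\<Sum>j\<in>J. c j * W' j \<omega>)\<^sup>2 \<partial>M')"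
    unfolding power2_eq_square
    using gaussian_space_integral_sum_mult_sum[OF G(1), of J J W W c c]
      gaussian_space_integral_sum_mult_sum[OF G(2), of J J W' W' c c] J m cov
    by (simp add: subset_iff)
  then show "(\<integral>\<omega>. cis (\<Sum>j\<in>J. c j * W j \<omega>) \<partial>M) = (\<integral>\<omega>. cis (\<Sum>j\<in>J. c j * W' j \<omega>) \<partial>M')"
    using gaussian_space_integrable(3)[OF G(1) gaussian_space_sum[OF G(1) J(1) m(1)]]
      gaussian_space_integrable(3)[OF G(2) gaussian_space_sum[OF G(2) J(1) m(2)]] by simp
qed (use G W gaussian_space_prob gaussian_space_measurable in blast)+

text \<open>The characteristic functions of \<open>(W, U)\<close> on \<open>M\<close> and of the product family on
  \<open>M \<Otimes>\<^sub>M M\<close> agree; both are indexed by the disjoint sum of the index sets.\<close>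

lemma gaussian_uncorrelated_indep:
  fixes W :: "'i \<Rightarrow> 'a \<Rightarrow> real" and U :: "'j \<Rightarrow> 'a \<Rightarrow> real"
  assumes G: "gaussian_space M G"
    and W: "\<And>i. i \<in> I \<Longrightarrow> W i \<in> G" and U: "\<And>k. k \<in> K \<Longrightarrow> U k \<in> G"
    and cov: "\<And>i k. i \<in> I \<Longrightarrow> k \<in> K \<Longrightarrow> (\<integral>\<omega>. W i \<omega> * U k \<omega> \<partial>M) = 0"
  shows "distr M ((\<Pi>\<^sub>M i\<in>I. borel) \<Otimes>\<^sub>M (\<Pi>\<^sub>M k\<in>K. borel)) (\<lambda>\<omega>. (\<lambda>i\<in>I. W i \<omega>, \<lambda>k\<in>K. U k \<omega>)) =
    distr M (\<Pi>\<^sub>M i\<in>I. borel) (\<lambda>\<omega>. \<lambda>i\<in>I. W i \<omega>) \<Otimes>\<^sub>M distr M (\<Pi>\<^sub>M k\<in>K. borel) (\<lambda>\<omega>. \<lambda>k\<in>K. U k \<omega>)"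
proof -
  interpret prob_space M by (rule gaussian_space_prob[OF G])
  interpret P: pair_prob_space M M ..
  have mW: "W i \<in> borel_measurable M" if "i \<in> I" for i using W G gaussian_space_measurable that by blast
  have mU: "U k \<in> borel_measurable M" if "k \<in> K" for k using U G gaussian_space_measurable that by blast
  have mm: "(\<lambda>\<omega>. \<lambda>i\<in>I. W i \<omega>) \<in> measurable M (\<Pi>\<^sub>M i\<in>I. borel)" "(\<lambda>\<omega>. \<lambda>k\<in>K. U k \<omega>) \<in> measurable M (\<Pi>\<^sub>M k\<in>K. borel)"
    using mW mU by (auto intro!: measurable_restrict)
  define V where "V = case_sum W U"
  define V' where "V' = case_sum (\<lambda>i \<omega>. W i (fst \<omega>)) (\<lambda>k \<omega>. U k (snd \<omega>))"
  \<comment> \<open>\<open>\<phi>\<close> splits a family over the disjoint sum into its two halves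
    and so carries an equality of laws over \<open>I <+> K\<close> to the product of the two
    spaces.\<close>
  define \<phi> where "\<phi> p = (\<lambda>i\<in>I. p (Inl i) :: real, \<lambda>k\<in>K. p (Inr k) :: real)" for p
  have \<phi>: "\<phi> \<in> measurable (\<Pi>\<^sub>M j\<in>I <+> K. borel) ((\<Pi>\<^sub>M i\<in>I. borel) \<Otimes>\<^sub>M (\<Pi>\<^sub>M k\<in>K. borel))"
    unfolding \<phi>_def by (intro measurable_Pair measurable_restrict measurable_component_singleton) auto
  have mV: "V j \<in> borel_measurable M" "V' j \<in> borel_measurable (M \<Otimes>\<^sub>M M)" if "j \<in> I <+> K" for j
    using that mW mU by (auto simp: V_def V'_def intro: measurable_compose[OF measurable_fst] measurable_compose[OF measurable_snd])
  have "distr M (\<Pi>\<^sub>M j\<in>I <+> K. borel) (\<lambda>\<omega>. \<lambda>j\<in>I <+> K. V j \<omega>) =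
      distr (M \<Otimes>\<^sub>M M) (\<Pi>\<^sub>M j\<in>I <+> K. borel) (\<lambda>\<omega>. \<lambda>j\<in>I <+> K. V' j \<omega>)"
  proof (rule cramer_wold)
    fix J :: "('i + 'j) set" and c assume J: "finite J" "J \<subseteq> I <+> K"
    define A B where "A = Inl -` J" and "B = Inr -` J"
    have AB: "finite A" "finite B" "A \<subseteq> I" "B \<subseteq> K" "J = A <+> B"
      using J by (auto simp: A_def B_def intro: finite_vimageI)
    define f g where "f \<omega> = (\<Sum>i\<in>A. c (Inl i) * W i \<omega>)" and "g \<omega> = (\<Sum>k\<in>B. c (Inr k) * U k \<omega>)" for \<omega>
    have fG: "f \<in> G" and gG: "g \<in> G"
      unfolding f_def[abs_def] g_def[abs_def] using AB W U by (auto intro!: gaussian_space_sum[OF G])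
    have [measurable]: "f \<in> borel_measurable M" "g \<in> borel_measurable M"
      using fG gG gaussian_space_measurable[OF G] by auto
    have fg0: "(\<integral>\<omega>. f \<omega> * g \<omega> \<partial>M) = 0"
      unfolding f_def g_def using AB W U cov
      by (subst gaussian_space_integral_sum_mult_sum[OF G]) (auto intro!: sum.neutral simp: subset_iff)
    \<comment> \<open>As the cross term vanishes, the variance is additive and the Gaussian
      characteristic function factorizes.\<close>
    have "(\<integral>\<omega>. (f \<omega> + 1 * g \<omega>)\<^sup>2 \<partial>M) = (\<integral>\<omega>. (f \<omega>)\<^sup>2 + (g \<omega>)\<^sup>2 + 2 * (f \<omega> * g \<omega>) \<partial>M)"
      by (simp add: power2_eq_square algebra_simps)
    also have "\<dots> = (\<integral>\<omega>. (f \<omega>)\<^sup>2 \<partial>M) + (\<integral>\<omega>. (g \<omega>)\<^sup>2 \<partial>M)"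
      using gaussian_space_integrable(2)[OF G fG] gaussian_space_integrable(2)[OF G gG]
        gaussian_space_integrable_mult[OF G fG gG] fg0 by simp
    finally have v: "(\<integral>\<omega>. (f \<omega> + 1 * g \<omega>)\<^sup>2 \<partial>M) = (\<integral>\<omega>. (f \<omega>)\<^sup>2 \<partial>M) + (\<integral>\<omega>. (g \<omega>)\<^sup>2 \<partial>M)" .
    have "(\<integral>\<omega>. cis (\<Sum>j\<in>J. c j * V j \<omega>) \<partial>M) = (\<integral>\<omega>. cis (f \<omega> + 1 * g \<omega>) \<partial>M)"
      using AB by (simp add: sum.Plus V_def f_def g_def)
    also have "\<dots> = exp (- ((\<integral>\<omega>. (f \<omega>)\<^sup>2 \<partial>M) + (\<integral>\<omega>. (g \<omega>)\<^sup>2 \<partial>M)) / 2)"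
      unfolding v[symmetric] by (rule gaussian_space_integrable(3)[OF G gaussian_space_add[OF G fG gG]])
    also have "\<dots> = (\<integral>\<omega>. cis (f \<omega>) \<partial>M) * (\<integral>\<omega>. cis (g \<omega>) \<partial>M)"
      unfolding gaussian_space_integrable(3)[OF G fG] gaussian_space_integrable(3)[OF G gG]
      unfolding of_real_mult[symmetric] exp_add[symmetric] by (simp add: add_divide_distrib)
    also have "\<dots> = (\<integral>x. (\<integral>y. cis (f x) * cis (g y) \<partial>M) \<partial>M)"
      by simp
    also have "\<dots> = (\<integral>p. cis (f (fst p)) * cis (g (snd p)) \<partial>(M \<Otimes>\<^sub>M M))"
      using P.integral_fst'[of "\<lambda>p. cis (f (fst p)) * cis (g (snd p))"]
      by (simp add: P.integrable_const_bound[where B = 1] norm_mult)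
    also have "\<dots> = (\<integral>p. cis (\<Sum>j\<in>J. c j * V' j p) \<partial>(M \<Otimes>\<^sub>M M))"
      using AB by (simp add: sum.Plus V'_def f_def g_def cis_mult)
    finally show "(\<integral>\<omega>. cis (\<Sum>j\<in>J. c j * V j \<omega>) \<partial>M) = (\<integral>p. cis (\<Sum>j\<in>J. c j * V' j p) \<partial>(M \<Otimes>\<^sub>M M))" .
  qed (use mV in \<open>auto intro: prob_space_axioms P.prob_space_axioms\<close>)
  then have "distr (distr M (\<Pi>\<^sub>M j\<in>I <+> K. borel) (\<lambda>\<omega>. \<lambda>j\<in>I <+> K. V j \<omega>)) ((\<Pi>\<^sub>M i\<in>I. borel) \<Otimes>\<^sub>M (\<Pi>\<^sub>M k\<in>K. borel)) \<phi> =
      distr (distr (M \<Otimes>\<^sub>M M) (\<Pi>\<^sub>M j\<in>I <+> K. borel) (\<lambda>\<omega>. \<lambda>j\<in>I <+> K. V' j \<omega>)) ((\<Pi>\<^sub>M i\<in>I. borel) \<Otimes>\<^sub>M (\<Pi>\<^sub>M k\<in>K. borel)) \<phi>"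
    by simp
  then have "distr M ((\<Pi>\<^sub>M i\<in>I. borel) \<Otimes>\<^sub>M (\<Pi>\<^sub>M k\<in>K. borel)) (\<lambda>\<omega>. (\<lambda>i\<in>I. W i \<omega>, \<lambda>k\<in>K. U k \<omega>)) =
      distr (M \<Otimes>\<^sub>M M) ((\<Pi>\<^sub>M i\<in>I. borel) \<Otimes>\<^sub>M (\<Pi>\<^sub>M k\<in>K. borel)) (\<lambda>(\<omega>, \<omega>'). (\<lambda>i\<in>I. W i \<omega>, \<lambda>k\<in>K. U k \<omega>'))"
    using mV by (simp add: distr_distr[OF \<phi>] measurable_restrict comp_def \<phi>_def V_def V'_def case_prod_unfold InlI InrI cong: restrict_cong)
  also have "\<dots> = distr M (\<Pi>\<^sub>M i\<in>I. borel) (\<lambda>\<omega>. \<lambda>i\<in>I. W i \<omega>) \<Otimes>\<^sub>M distr M (\<Pi>\<^sub>M k\<in>K. borel) (\<lambda>\<omega>. \<lambda>k\<in>K. U k \<omega>)"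
    using mm by (intro pair_measure_distr[symmetric] prob_space_imp_sigma_finite prob_space_distr)
  finally show ?thesis .
qed

text \<open>Serves to pass from the product law of two whole families to that of single coordinates,
  or of a vector built from one of them.\<close>

lemma distr_pair_product_map:
  assumes M: "prob_space M" and f: "f \<in> measurable M N" and g: "g \<in> measurable M N'"
    and eq: "distr M (N \<Otimes>\<^sub>M N') (\<lambda>\<omega>. (f \<omega>, g \<omega>)) = distr M N f \<Otimes>\<^sub>M distr M N' g"
    and h: "h \<in> measurable N L" and h': "h' \<in> measurable N' L'"
  shows "distr M (L \<Otimes>\<^sub>M L') (\<lambda>\<omega>. (h (f \<omega>), h' (g \<omega>))) = distr M L (\<lambda>\<omega>. h (f \<omega>)) \<Otimes>\<^sub>M distr M L' (\<lambda>\<omega>. h' (g \<omega>))"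
proof -
  interpret prob_space M by fact
  have hf: "(\<lambda>\<omega>. h (f \<omega>)) \<in> measurable M L" and hg: "(\<lambda>\<omega>. h' (g \<omega>)) \<in> measurable M L'"
    using measurable_compose[OF f h] measurable_compose[OF g h'] .
  have hh: "(\<lambda>(x, y). (h x, h' y)) \<in> measurable (N \<Otimes>\<^sub>M N') (L \<Otimes>\<^sub>M L')"
    using h h' by measurable
  have "distr M L (\<lambda>\<omega>. h (f \<omega>)) \<Otimes>\<^sub>M distr M L' (\<lambda>\<omega>. h' (g \<omega>)) = distr (distr M N f) L h \<Otimes>\<^sub>M distr (distr M N' g) L' h'"
    using f g h h' by (simp add: distr_distr comp_def)
  also have "\<dots> = distr (distr M N f \<Otimes>\<^sub>M distr M N' g) (L \<Otimes>\<^sub>M L') (\<lambda>(x, y). (h x, h' y))"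
    using f g h h' hg by (intro pair_measure_distr prob_space_imp_sigma_finite)
      (auto simp: distr_distr comp_def intro: prob_space_distr)
  also have "\<dots> = distr (distr M (N \<Otimes>\<^sub>M N') (\<lambda>\<omega>. (f \<omega>, g \<omega>))) (L \<Otimes>\<^sub>M L') (\<lambda>(x, y). (h x, h' y))"
    by (simp add: eq)
  also have "\<dots> = distr M (L \<Otimes>\<^sub>M L') (\<lambda>\<omega>. (h (f \<omega>), h' (g \<omega>)))"
    using f g hh by (simp add: distr_distr comp_def)
  finally show ?thesis by simp
qed

section \<open>Gaussian processes determined by their covariance\<close>

definition lin_span :: "'i set \<Rightarrow> ('i \<Rightarrow> 'a \<Rightarrow> real) \<Rightarrow> ('a \<Rightarrow> real) set" where
  "lin_span I W = {f. \<exists>J c. finite J \<and> J \<subseteq> I \<and> f = (\<lambda>\<omega>. \<Sum>j\<in>J. c j * W j \<omega>)}"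

lemma lin_spanE:
  assumes "f \<in> lin_span I W"
  obtains J c where "finite J" "J \<subseteq> I" "f = (\<lambda>\<omega>. \<Sum>j\<in>J. c j * W j \<omega>)"
  using assms unfolding lin_span_def mem_Collect_eq by (elim exE conjE) (rule that)

lemma lin_span_base: "i \<in> I \<Longrightarrow> W i \<in> lin_span I W"
  unfolding lin_span_def by (rule CollectI, rule exI[of _ "{i}"], rule exI[of _ "\<lambda>_. 1"]) simp

lemma lin_span_add:
  assumes "f \<in> lin_span I W" "g \<in> lin_span I W"
  shows "(\<lambda>\<omega>. f \<omega> + a * g \<omega>) \<in> lin_span I W"
proof -
  obtain J c where J: "finite J" "J \<subseteq> I" "f = (\<lambda>\<omega>. \<Sum>j\<in>J. c j * W j \<omega>)"
    by (rule lin_spanE[OF assms(1)])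
  obtain L d where L: "finite L" "L \<subseteq> I" "g = (\<lambda>\<omega>. \<Sum>j\<in>L. d j * W j \<omega>)"
    by (rule lin_spanE[OF assms(2)])
  \<comment> \<open>Both combinations are extended by zero coefficients to the union of their index
    sets.\<close>
  let ?e = "\<lambda>j. (if j \<in> J then c j else 0) + a * (if j \<in> L then d j else 0)"
  have "f \<omega> + a * g \<omega> = (\<Sum>j\<in>J \<union> L. ?e j * W j \<omega>)" for \<omega>
  proof -
    have "f \<omega> = (\<Sum>j\<in>J \<union> L. (if j \<in> J then c j else 0) * W j \<omega>)"
      unfolding J(3) using J(1) L(1) by (intro sum.mono_neutral_cong_left) auto
    moreover have "g \<omega> = (\<Sum>j\<in>J \<union> L. (if j \<in> L then d j else 0) * W j \<omega>)"
      unfolding L(3) using J(1) L(1) by (intro sum.mono_neutral_cong_left) auto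
    ultimately show ?thesis
      by (simp add: distrib_right sum.distrib sum_distrib_left mult.assoc)
  qed
  then show ?thesis
    unfolding lin_span_def using J(1,2) L(1,2)
    by (intro CollectI exI[of _ "J \<union> L"] exI[of _ ?e]) auto
qed

lemma gaussian_space_lin_span:
  assumes M: "prob_space M"
    and g: "\<And>J c. finite J \<Longrightarrow> J \<subseteq> I \<Longrightarrow> gaussian_rv M (\<lambda>\<omega>. \<Sum>j\<in>J. c j * W j \<omega>)"
    and mean: "\<And>i. i \<in> I \<Longrightarrow> integral\<^sup>L M (W i) = 0"
  shows "gaussian_space M (lin_span I W)"
proof -
  have int: "integrable M (W i)" if "i \<in> I" for i
    using centered_gaussian_rv(1)[OF M _ mean[OF that]] g[of "{i}" "\<lambda>_. 1"] that by simp
  have z: "(\<lambda>_. 0) \<in> lin_span I W"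
    unfolding lin_span_def by (rule CollectI, rule exI[of _ "{}"]) simp
  have "gaussian_rv M f \<and> integral\<^sup>L M f = 0" if "f \<in> lin_span I W" for f
  proof -
    obtain J c where J: "finite J" "J \<subseteq> I" "f = (\<lambda>\<omega>. \<Sum>j\<in>J. c j * W j \<omega>)"
      using lin_spanE[OF \<open>f \<in> lin_span I W\<close>] .
    have "integral\<^sup>L M f = (\<Sum>j\<in>J. \<integral>\<omega>. c j * W j \<omega> \<partial>M)"
      unfolding J(3) using J(2) int by (intro Bochner_Integration.integral_sum integrable_mult_right) auto
    also have "\<dots> = (\<Sum>j\<in>J. c j * integral\<^sup>L M (W j))" by simp
    also have "\<dots> = 0" using J(2) mean by (intro sum.neutral) auto
    finally show ?thesis using g[OF J(1,2)] J(3) by simp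
  qed
  then show ?thesis
    unfolding gaussian_space_def using M z lin_span_add by blast
qed

text \<open>Freezing: as \<open>P\<close> and \<open>R\<close> are independent, conditioning on
  \<open>P\<close> fixes the first summand and leaves the second with its own law. The result
  depends on \<open>P\<close> only through \<open>h\<close>, which makes conditioning on the past
  comparable with conditioning on the present.\<close>

lemma real_cond_exp_indep_sum:
  fixes R :: "'a \<Rightarrow> real"
  assumes M: "prob_space M" and P[measurable]: "P \<in> measurable M N" and R[measurable]: "R \<in> borel_measurable M"
    and prod: "distr M (N \<Otimes>\<^sub>M borel) (\<lambda>\<omega>. (P \<omega>, R \<omega>)) = distr M N P \<Otimes>\<^sub>M distr M borel R"
    and h[measurable]: "h \<in> borel_measurable N" and A[measurable]: "A \<in> sets borel"
  shows "AE \<omega> in M. real_cond_exp M (vimage_algebra (space M) P N) (\<lambda>\<omega>'. indicator A (h (P \<omega>') + R \<omega>')) \<omega> =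
    (\<integral>\<omega>'. indicator A (h (P \<omega>) + R \<omega>') \<partial>M)"
proof -
  interpret prob_space M by fact
  let ?F = "vimage_algebra (space M) P N"
  have Psp: "P \<in> space M \<rightarrow> space N" using measurable_space[OF P] by auto
  have F: "sets ?F = {P -` B \<inter> space M | B. B \<in> sets N}"
    using Psp by (rule sets_vimage_algebra2)
  have sub: "subalgebra M ?F"
    unfolding subalgebra_def F using P by (auto intro: measurable_sets)
  interpret finite_measure_subalgebra M ?F by standard (rule sub)
  interpret DR: prob_space "distr M borel R" by (rule prob_space_distr) simp
  interpret DP: prob_space "distr M N P" by (rule prob_space_distr) simp
  interpret PP: pair_prob_space "distr M N P" "distr M borel R" ..
  define \<phi> :: "'b \<Rightarrow> real" where "\<phi> p = (\<integral>r. indicator A (h p + r) \<partial>distr M borel R)" for p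
  have \<phi>_eq: "\<phi> p = (\<integral>\<omega>'. indicator A (h p + R \<omega>') \<partial>M)" for p
    unfolding \<phi>_def by (subst integral_distr) auto
  have \<phi>[measurable]: "\<phi> \<in> borel_measurable N"
    unfolding \<phi>_def by measurable
  have \<phi>1: "norm (\<phi> p) \<le> 1" for p
  proof -
    have "integrable M (\<lambda>\<omega>'. indicator A (h p + R \<omega>') :: real)"
      by (rule integrable_const_bound[where B = 1]) auto
    then have "0 \<le> \<phi> p" "\<phi> p \<le> 1"
      unfolding \<phi>_eq by (auto intro!: integral_ge_const integral_le_const)
    then show ?thesis by simp
  qed
  have "AE \<omega> in M. real_cond_exp M ?F (\<lambda>\<omega>'. indicator A (h (P \<omega>') + R \<omega>')) \<omega> = \<phi> (P \<omega>)"
  proof (rule real_cond_exp_charact)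
    show "integrable M (\<lambda>\<omega>'. indicator A (h (P \<omega>') + R \<omega>') :: real)"
      by (rule integrable_const_bound[where B = 1]) auto
    show "integrable M (\<lambda>\<omega>. \<phi> (P \<omega>))"
      by (rule integrable_const_bound[where B = 1]) (use \<phi>1 in auto)
    show "(\<lambda>\<omega>. \<phi> (P \<omega>)) \<in> borel_measurable ?F"
      by (rule measurable_compose[OF measurable_vimage_algebra1[OF Psp] \<phi>])
    \<comment> \<open>Events of the conditioning algebra are preimages under \<open>P\<close>, so
      the identity that characterizes the conditional expectation becomes Fubini for the product
      law.\<close>
    fix C assume "C \<in> sets ?F"
    then obtain B where B[measurable]: "B \<in> sets N" and C: "C = P -` B \<inter> space M" unfolding F by blast
    have ind: "indicator C \<omega> = (indicator B (P \<omega>) :: real)" if "\<omega> \<in> space M" for \<omega>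
      using that by (simp add: C indicator_def)
    have "(\<integral>\<omega>\<in>C. (indicator A (h (P \<omega>) + R \<omega>) :: real) \<partial>M) = (\<integral>\<omega>. indicator B (P \<omega>) * indicator A (h (P \<omega>) + R \<omega>) \<partial>M)"
      unfolding set_lebesgue_integral_def by (intro Bochner_Integration.integral_cong) (auto simp: ind)
    also have "\<dots> = (\<integral>x. indicator B (fst x) * indicator A (h (fst x) + snd x) \<partial>distr M (N \<Otimes>\<^sub>M borel) (\<lambda>\<omega>. (P \<omega>, R \<omega>)))"
      by (subst integral_distr) auto
    also have "\<dots> = (\<integral>p. (\<integral>r. indicator B p * indicator A (h p + r) \<partial>distr M borel R) \<partial>distr M N P)"
      unfolding prod
      using PP.integral_fst'[of "\<lambda>x. indicator B (fst x) * indicator A (h (fst x) + snd x) :: real"]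
      by (simp add: PP.integrable_const_bound[where B = 1] indicator_def)
    also have "\<dots> = (\<integral>p. indicator B p * \<phi> p \<partial>distr M N P)"
      by (simp add: \<phi>_def)
    also have "\<dots> = (\<integral>\<omega>. indicator B (P \<omega>) * \<phi> (P \<omega>) \<partial>M)"
      by (subst integral_distr) auto
    also have "\<dots> = (\<integral>\<omega>\<in>C. \<phi> (P \<omega>) \<partial>M)"
      unfolding set_lebesgue_integral_def by (intro Bochner_Integration.integral_cong) (auto simp: ind)
    finally show "(\<integral>\<omega>\<in>C. indicator A (h (P \<omega>) + R \<omega>) \<partial>M) = (\<integral>\<omega>\<in>C. \<phi> (P \<omega>) \<partial>M)" .
  qed
  then show ?thesis unfolding \<phi>_eq .
qed

section \<open>Stationary increments and the Markov property from the covariance\<close>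

context
  fixes M :: "'a measure" and X :: "real \<Rightarrow> 'a \<Rightarrow> real" and T :: "real set" and \<theta> \<tau> :: real
  assumes M: "prob_space M" and gp: "gaussian_process M T X"
    and mean: "\<And>t. t \<in> T \<Longrightarrow> integral\<^sup>L M (X t) = 0"
    and cov: "\<And>s t. s \<in> T \<Longrightarrow> t \<in> T \<Longrightarrow> s \<le> t \<Longrightarrow> (\<integral>\<omega>. X s \<omega> * X t \<omega> \<partial>M) = s * (\<theta> - \<tau> * t)"
begin

lemma gaussian_process_space: "gaussian_space M (lin_span T X)"
  using M gp mean by (intro gaussian_space_lin_span) (auto simp: gaussian_process_def)

lemma integrable_mult_process: "s \<in> T \<Longrightarrow> t \<in> T \<Longrightarrow> integrable M (\<lambda>\<omega>. X s \<omega> * X t \<omega>)"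
  by (intro gaussian_space_integrable_mult[OF gaussian_process_space] lin_span_base)

text \<open>After expansion all terms in \<open>s\<close> cancel, so the increments from
  \<open>s\<close> have the covariance of the process itself.\<close>

lemma increment_covariance_le:
  assumes "s \<in> T" "s + h \<in> T" "s + h' \<in> T" "0 \<le> h" "h \<le> h'"
  shows "(\<integral>\<omega>. (X (s + h) \<omega> - X s \<omega>) * (X (s + h') \<omega> - X s \<omega>) \<partial>M) = h * (\<theta> - \<tau> * h')"
proof -
  note I = integrable_mult_process
  have "(\<integral>\<omega>. (X (s + h) \<omega> - X s \<omega>) * (X (s + h') \<omega> - X s \<omega>) \<partial>M) =
      (\<integral>\<omega>. X (s + h) \<omega> * X (s + h') \<omega> - X s \<omega> * X (s + h) \<omega> - X s \<omega> * X (s + h') \<omega> + X s \<omega> * X s \<omega> \<partial>M)"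
    by (intro Bochner_Integration.integral_cong) (auto simp: algebra_simps)
  also have "\<dots> = (s + h) * (\<theta> - \<tau> * (s + h')) - s * (\<theta> - \<tau> * (s + h)) - s * (\<theta> - \<tau> * (s + h')) + s * (\<theta> - \<tau> * s)"
    using assms by (simp add: I cov)
  also have "\<dots> = h * (\<theta> - \<tau> * h')" by (simp add: algebra_simps)
  finally show ?thesis .
qed

text \<open>Symmetric in \<open>h\<close> and \<open>h'\<close>, since
  \<open>gaussian_law_unique\<close> asks for pairs in either order.\<close>

lemma increment_covariance:
  assumes "s \<in> T" "s + h \<in> T" "s + h' \<in> T" "0 \<le> h" "0 \<le> h'"
  shows "(\<integral>\<omega>. (X (s + h) \<omega> - X s \<omega>) * (X (s + h') \<omega> - X s \<omega>) \<partial>M) = min h h' * (\<theta> - \<tau> * max h h')"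
  using increment_covariance_le[of s h h'] increment_covariance_le[of s h' h] assms
  by (cases "h \<le> h'") (simp_all add: mult.commute min_def max_def)

lemma gaussian_stationary_increments: "stationary_increments M T X"
  unfolding stationary_increments_def
proof (intro ballI allI impI)
  fix s t J assume st: "s \<in> T" "t \<in> T" and J: "finite J \<and> (\<forall>h\<in>J. 0 \<le> h \<and> s + h \<in> T \<and> t + h \<in> T)"
  have d: "(\<lambda>\<omega>. X a \<omega> - X b \<omega>) \<in> lin_span T X" if "a \<in> T" "b \<in> T" for a b
    using lin_span_add[of "X a" T X "X b" "-1"] that by (simp add: lin_span_base)
  show "distr M (\<Pi>\<^sub>M h\<in>J. borel) (\<lambda>\<omega>. \<lambda>h\<in>J. X (s + h) \<omega> - X s \<omega>) =
        distr M (\<Pi>\<^sub>M h\<in>J. borel) (\<lambda>\<omega>. \<lambda>h\<in>J. X (t + h) \<omega> - X t \<omega>)"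
    by (rule gaussian_law_unique[OF gaussian_process_space gaussian_process_space])
      (use st J in \<open>auto intro!: d simp: increment_covariance\<close>)
qed

text \<open>For r <= s the ratio of the covariances of X_r with X_t and with X_s is (theta - tau t)
  / (theta - tau s), the same for every r. Hence one multiple of \<open>X s\<close> decorrelates
  \<open>X t\<close> from the whole past; \<open>pos\<close> keeps the denominator positive.\<close>

lemma gaussian_markov:
  assumes pos: "\<And>s. s \<in> T \<Longrightarrow> \<tau> * s < \<theta>"
  shows "markov_process M T X"
  unfolding markov_process_def
proof (intro ballI impI)
  fix s t and A :: "real set" assume st: "s \<in> T" "t \<in> T" "s \<le> t" and A: "A \<in> sets borel"
  note G = gaussian_process_space
  interpret prob_space M by (rule M)
  define I where "I = {r \<in> T. r \<le> s}"
  have sI: "s \<in> I" using st by (simp add: I_def)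
  define a where "a = (\<theta> - \<tau> * t) / (\<theta> - \<tau> * s)"
  have a: "a * (\<theta> - \<tau> * s) = \<theta> - \<tau> * t" using pos[OF st(1)] by (simp add: a_def)
  define R where "R \<omega> = X t \<omega> + (-a) * X s \<omega>" for \<omega>
  have RG: "R \<in> lin_span T X" unfolding R_def[abs_def] using st by (intro lin_span_add lin_span_base)
  have XG: "X r \<in> lin_span T X" if "r \<in> I" for r using that by (auto simp: I_def lin_span_base)
  have mX[measurable]: "X r \<in> borel_measurable M" if "r \<in> I" for r
    using gaussian_space_measurable[OF G XG[OF that]] .
  have mR[measurable]: "R \<in> borel_measurable M" using gaussian_space_measurable[OF G RG] .
  have unc: "(\<integral>\<omega>. X r \<omega> * R \<omega> \<partial>M) = 0" if "r \<in> I" for r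
  proof -
    have r: "r \<in> T" "r \<le> s" "r \<le> t" using that st by (auto simp: I_def)
    have "(\<integral>\<omega>. X r \<omega> * R \<omega> \<partial>M) = (\<integral>\<omega>. X r \<omega> * X t \<omega> - a * (X r \<omega> * X s \<omega>) \<partial>M)"
      by (simp add: R_def algebra_simps)
    also have "\<dots> = r * (\<theta> - \<tau> * t) - r * (a * (\<theta> - \<tau> * s))"
      using r st by (simp add: integrable_mult_process cov)
    finally show ?thesis by (simp add: a)
  qed
  let ?P = "\<lambda>\<omega>. \<lambda>r\<in>I. X r \<omega>"
  have mP: "?P \<in> measurable M (\<Pi>\<^sub>M r\<in>I. borel)" by (intro measurable_restrict mX)
  \<comment> \<open>\<open>R\<close> is viewed as a family indexed by \<open>unit\<close>, the form
    in which independence is available.\<close>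
  have mRR: "(\<lambda>\<omega>. \<lambda>_\<in>UNIV::unit set. R \<omega>) \<in> measurable M (\<Pi>\<^sub>M _\<in>UNIV::unit set. borel)"
    by (intro measurable_restrict mR)
  note indep = gaussian_uncorrelated_indep[OF G XG, where I = I and K = "UNIV :: unit set" and U = "\<lambda>_. R", OF _ RG unc]
  have p1: "distr M ((\<Pi>\<^sub>M r\<in>I. borel) \<Otimes>\<^sub>M borel) (\<lambda>\<omega>. (?P \<omega>, R \<omega>)) = distr M (\<Pi>\<^sub>M r\<in>I. borel) ?P \<Otimes>\<^sub>M distr M borel R"
    using distr_pair_product_map[OF M mP mRR indep, of "\<lambda>w. w" "\<Pi>\<^sub>M r\<in>I. borel" "\<lambda>w. w ()" borel] by simp
  have p2: "distr M (borel \<Otimes>\<^sub>M borel) (\<lambda>\<omega>. (X s \<omega>, R \<omega>)) = distr M borel (X s) \<Otimes>\<^sub>M distr M borel R"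
    using distr_pair_product_map[OF M mP mRR indep, of "\<lambda>w. w s" borel "\<lambda>w. w ()" borel] sI by simp
  have eq: "X t \<omega> = a * X s \<omega> + R \<omega>" for \<omega> by (simp add: R_def)
  \<comment> \<open>The past contains \<open>X s\<close> itself, so conditioning on the past and on
    \<open>X s\<close> yields the same function of \<open>X s\<close>.\<close>
  have "AE \<omega> in M. real_cond_exp M (vimage_algebra (space M) ?P (\<Pi>\<^sub>M r\<in>I. borel))
      (\<lambda>\<omega>'. indicator A (a * ?P \<omega>' s + R \<omega>')) \<omega> = (\<integral>\<omega>'. indicator A (a * ?P \<omega> s + R \<omega>') \<partial>M)"
    by (rule real_cond_exp_indep_sum[OF M mP mR p1 _ A]) (use sI in measurable)
  moreover have "AE \<omega> in M. real_cond_exp M (vimage_algebra (space M) (X s) borel)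
      (\<lambda>\<omega>'. indicator A (a * X s \<omega>' + R \<omega>')) \<omega> = (\<integral>\<omega>'. indicator A (a * X s \<omega> + R \<omega>') \<partial>M)"
    by (rule real_cond_exp_indep_sum[OF M mX[OF sI] mR p2 _ A]) measurable
  ultimately show "AE \<omega> in M. real_cond_exp M (past_algebra M T X s) (\<lambda>\<omega>'. indicator A (X t \<omega>')) \<omega> =
      real_cond_exp M (vimage_algebra (space M) (X s) borel) (\<lambda>\<omega>'. indicator A (X t \<omega>')) \<omega>"
    using sI by (auto simp: past_algebra_def eq simp flip: I_def)
qed

end

text \<open>Strictness comes from s < Delta; for infinite Delta the bound on \<open>\<tau>\<close>
  reads \<open>\<tau> \<le> 0\<close>. The conclusion keeps the denominators of the regression
  coefficients positive and the variance positive at times s > 0.\<close>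

lemma time_interval_less:
  assumes "0 < \<theta>" "ereal \<tau> \<le> ereal \<theta> / \<Delta>" "0 < \<Delta>" "s \<in> time_interval \<Delta>"
  shows "\<tau> * s < \<theta>"
proof (cases \<Delta>)
  case (real d)
  then have d: "0 \<le> s" "s < d" "0 < d" "\<tau> \<le> \<theta> / d" using assms by (auto simp: time_interval_def)
  show ?thesis
  proof (cases "\<tau> \<le> 0")
    case True
    then show ?thesis using assms(1) d mult_nonpos_nonneg[of \<tau> s] by linarith
  next
    case False
    then have "\<tau> * s < \<tau> * d" using d by simp
    also have "\<dots> \<le> \<theta>" using d by (simp add: field_simps)
    finally show ?thesis .
  qed
next
  case PInf
  then have "\<tau> \<le> 0" "0 \<le> s" using assms by (auto simp: time_interval_def)
  then show ?thesis using assms(1) mult_nonpos_nonneg[of \<tau> s] by linarith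
next
  case MInf
  then show ?thesis using assms by simp
qed

lemma gmsi_processI:
  assumes "0 < \<Delta>" "0 < \<theta>" "ereal \<tau> \<le> ereal \<theta> / \<Delta>" "prob_space M"
    and "\<And>t. t \<in> time_interval \<Delta> \<Longrightarrow> X t \<in> borel_measurable M"
    and "\<And>\<omega>. \<omega> \<in> space M \<Longrightarrow> continuous_on (time_interval \<Delta>) (\<lambda>t. X t \<omega>)"
    and "AE \<omega> in M. X 0 \<omega> = 0"
    and "\<And>t. t \<in> time_interval \<Delta> \<Longrightarrow> integral\<^sup>L M (X t) = 0"
    and "gaussian_process M (time_interval \<Delta>) X"
    and "\<And>s t. s \<in> time_interval \<Delta> \<Longrightarrow> t \<in> time_interval \<Delta> \<Longrightarrow> s \<le> t \<Longrightarrow>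
      (\<integral>\<omega>. X s \<omega> * X t \<omega> \<partial>M) = s * (\<theta> - \<tau> * t)"
  shows "gmsi_process M X \<theta> \<tau> \<Delta>"
  unfolding gmsi_process_def Let_def
  using assms gaussian_markov[OF assms(4,9,8,10)] gaussian_stationary_increments[OF assms(4,9,8,10)]
    time_interval_less[OF assms(2,3,1)]
  by blast

lemma gaussian_rv_distr:
  assumes f: "f \<in> measurable M N" and g: "g \<in> borel_measurable N" and gf: "gaussian_rv M (\<lambda>\<omega>. g (f \<omega>))"
  shows "gaussian_rv (distr M N f) g"
proof -
  have "(AE x in distr M N f. g x = \<mu>) \<longleftrightarrow> (AE \<omega> in M. g (f \<omega>) = \<mu>)" for \<mu>
    using f measurable_sets_Collect[OF g, of "\<lambda>x. x = \<mu>"] by (intro AE_distr_iff) auto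
  moreover have "distr (distr M N f) lborel g = distr M lborel (\<lambda>\<omega>. g (f \<omega>))"
    using f g by (simp add: distr_distr comp_def)
  ultimately show ?thesis
    using g gf f unfolding gaussian_rv_def distributed_def by auto
qed

section \<open>Uniqueness of the continuous conditional law\<close>

lemma measurable_path_space_coordinate:
  assumes "t \<in> T"
  shows "(\<lambda>w. w t) \<in> borel_measurable (path_space T)"
  unfolding path_space_def
  using assms by (intro measurable_restrict_space1 measurable_component_singleton) auto

lemma measurable_path_space_into:
  assumes "f \<in> measurable M (\<Pi>\<^sub>M t\<in>T. borel)" "\<And>\<omega>. \<omega> \<in> space M \<Longrightarrow> continuous_on T (f \<omega>)"
  shows "f \<in> measurable M (path_space T)"
  unfolding path_space_def using assms by (intro measurable_restrict_space2) auto

lemma continuous_on_restrict_iff: "continuous_on T (\<lambda>t\<in>T. f t) \<longleftrightarrow> continuous_on T f"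
  by (rule continuous_on_cong) auto

lemma measurable_path_map:
  assumes "\<And>t. t \<in> T \<Longrightarrow> Y t \<in> borel_measurable M" "\<And>\<omega>. \<omega> \<in> space M \<Longrightarrow> continuous_on T (\<lambda>t. Y t \<omega>)"
  shows "path_map T Y \<in> measurable M (path_space T)"
  unfolding path_map_def[abs_def]
  using assms by (intro measurable_path_space_into measurable_restrict) (auto simp: continuous_on_restrict_iff)

lemma measurable_path_space_PiM: "(\<lambda>w. w) \<in> measurable (path_space T) (\<Pi>\<^sub>M t\<in>T. borel)"
  unfolding path_space_def by (intro measurable_restrict_space1) simp

text \<open>\<open>path_space\<close> carries the trace sigma-algebra: its events are intersections
  of product sets \<open>B\<close> with the continuous paths. The measure of such an event is the
  mass of \<open>B\<close> under the image by inclusion, whether or not continuity is itself an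
  event of the product.\<close>

lemma path_space_measure_eqI:
  assumes P: "sets P = sets (path_space T)" and Q: "sets Q = sets (path_space T)"
    and eq: "distr P (\<Pi>\<^sub>M t\<in>T. borel) (\<lambda>w. w) = distr Q (\<Pi>\<^sub>M t\<in>T. borel) (\<lambda>w. w)"
  shows "P = Q"
proof (rule measure_eqI)
  show "sets P = sets Q" using P Q by simp
  fix A assume "A \<in> sets P"
  then obtain B where B: "B \<in> sets (\<Pi>\<^sub>M t\<in>T. borel)" and A: "A = {w. continuous_on T w} \<inter> B"
    unfolding P path_space_def sets_restrict_space by blast
  have sp: "space P = space (path_space T)" "space Q = space (path_space T)"
    using sets_eq_imp_space_eq[OF P] sets_eq_imp_space_eq[OF Q] .
  have "A = B \<inter> space (path_space T)"
    using sets.sets_into_space[OF B] unfolding A path_space_def space_restrict_space by auto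
  moreover have "(\<lambda>w. w) \<in> measurable P (\<Pi>\<^sub>M t\<in>T. borel)" "(\<lambda>w. w) \<in> measurable Q (\<Pi>\<^sub>M t\<in>T. borel)"
    using measurable_path_space_PiM by (simp_all add: measurable_cong_sets[OF P refl] measurable_cong_sets[OF Q refl])
  ultimately show "emeasure P A = emeasure Q A"
    using arg_cong[OF eq, of "\<lambda>N. emeasure N B"] B sp by (simp add: emeasure_distr)
qed

text \<open>For countably many real coordinates the product sigma-algebra is the Borel algebra of
  the product topology, so continuity of \<open>g\<close> suffices.\<close>

lemma measurable_path_space_sequence:
  fixes g :: "(nat \<Rightarrow> real) \<Rightarrow> real"
  assumes g: "continuous_on UNIV g" and t: "range t \<subseteq> T"
  shows "(\<lambda>w. g (\<lambda>i. w (t i))) \<in> borel_measurable (path_space T)"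
proof -
  have "(\<lambda>w i. w (t i)) \<in> measurable (path_space T) (\<Pi>\<^sub>M i\<in>UNIV. borel)"
    using t by (intro measurable_PiM_single' measurable_path_space_coordinate) auto
  moreover have "g \<in> borel_measurable (\<Pi>\<^sub>M i\<in>UNIV. borel)"
    using borel_measurable_continuous_onI[OF g] by (subst measurable_cong_sets[OF sets_PiM_equal_borel refl])
  ultimately show ?thesis by (rule measurable_compose)
qed

section \<open>Comparison of two conditional laws\<close>

lemma regular_conditional_lawD:
  assumes "regular_conditional_law M T Y V \<kappa>"
  shows "\<kappa> \<in> measurable borel (subprob_algebra (path_space T))"
    and "prob_space (\<kappa> v)" and "sets (\<kappa> v) = sets (path_space T)"
proof -
  have m: "\<kappa> \<in> measurable borel (prob_algebra (path_space T))"
    using assms by (simp add: regular_conditional_law_def)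
  then show "\<kappa> \<in> measurable borel (subprob_algebra (path_space T))" by (rule measurable_prob_algebraD)
  show "prob_space (\<kappa> v)" "sets (\<kappa> v) = sets (path_space T)"
    using measurable_space[OF m, of v] by (auto simp: space_prob_algebra)
qed

text \<open>Mixing a conditional kernel over the values in \<open>A\<close> gives the path law on
  the event that \<open>V\<close> lies in \<open>A\<close>. That measure is determined by
  \<open>M\<close>, hence is common to both kernels.\<close>

lemma regular_conditional_law_nn_integral_eq:
  assumes \<kappa>: "regular_conditional_law M T Y V \<kappa>" and \<kappa>': "regular_conditional_law M T Y V \<kappa>'"
    and A[measurable]: "A \<in> sets borel" and f: "f \<in> borel_measurable (path_space T)"
  shows "(\<integral>\<^sup>+v. indicator A v * (\<integral>\<^sup>+w. f w \<partial>\<kappa> v) \<partial>distr M borel V) =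
    (\<integral>\<^sup>+v. indicator A v * (\<integral>\<^sup>+w. f w \<partial>\<kappa>' v) \<partial>distr M borel V)"
proof -
  \<comment> \<open>The law of \<open>V\<close> cut down to \<open>A\<close>: finite, but in general
    not a probability measure.\<close>
  define D where "D = density (distr M borel V) (indicator A)"
  have sD: "sets D = sets borel" by (simp add: D_def)
  have emb: "sets (D \<bind> \<eta>) = sets (path_space T) \<and>
      (\<forall>B\<in>sets (path_space T). emeasure (D \<bind> \<eta>) B = emeasure M {\<omega>\<in>space M. V \<omega> \<in> A \<and> path_map T Y \<omega> \<in> B}) \<and>
      (\<integral>\<^sup>+w. f w \<partial>(D \<bind> \<eta>)) = (\<integral>\<^sup>+v. indicator A v * (\<integral>\<^sup>+w. f w \<partial>\<eta> v) \<partial>distr M borel V)"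
    if \<eta>: "regular_conditional_law M T Y V \<eta>" for \<eta>
  proof -
    note R = regular_conditional_lawD[OF \<eta>]
    have mD: "\<eta> \<in> measurable D (subprob_algebra (path_space T))"
      using R(1) by (simp add: measurable_cong_sets[OF sD refl])
    have spD: "space D \<noteq> {}" by (simp add: D_def)
    have "sets (D \<bind> \<eta>) = sets (path_space T)"
      by (rule sets_bind[OF R(3) spD])
    moreover have "emeasure (D \<bind> \<eta>) B = emeasure M {\<omega>\<in>space M. V \<omega> \<in> A \<and> path_map T Y \<omega> \<in> B}"
      if B: "B \<in> sets (path_space T)" for B
    proof -
      have [measurable]: "(\<lambda>v. emeasure (\<eta> v) B) \<in> borel_measurable borel"
        using measurable_emeasure_kernel[OF R(1) B] .
      show ?thesis
        unfolding emeasure_bind[OF spD mD B] using \<eta> B A unfolding regular_conditional_law_def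
        by (simp add: D_def nn_integral_density mult.commute)
    qed
    moreover have "(\<integral>\<^sup>+w. f w \<partial>(D \<bind> \<eta>)) = (\<integral>\<^sup>+v. indicator A v * (\<integral>\<^sup>+w. f w \<partial>\<eta> v) \<partial>distr M borel V)"
    proof -
      have [measurable]: "(\<lambda>v. \<integral>\<^sup>+w. f w \<partial>\<eta> v) \<in> borel_measurable borel"
        using measurable_compose[OF R(1) nn_integral_measurable_subprob_algebra[OF f]] .
      show ?thesis unfolding nn_integral_bind[OF f mD] by (simp add: D_def nn_integral_density)
    qed
    ultimately show ?thesis by blast
  qed
  have "D \<bind> \<kappa> = D \<bind> \<kappa>'"
    using emb[OF \<kappa>] emb[OF \<kappa>'] by (intro measure_eqI) auto
  then show ?thesis using emb[OF \<kappa>] emb[OF \<kappa>'] by simp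
qed

text \<open>If the inequality failed at \<open>x\<close>, weak continuity would make it fail on an
  open neighbourhood \<open>U\<close>. The two kernels have equal averages over \<open>U\<close>, so
  a strict inequality throughout \<open>U\<close> makes \<open>U\<close> null, against
  \<open>supp\<close>.\<close>

lemma continuous_conditional_law_integral_le:
  fixes V :: "'a \<Rightarrow> 'v::topological_space" and g :: "(nat \<Rightarrow> real) \<Rightarrow> real"
  assumes M: "prob_space M" and V[measurable]: "V \<in> borel_measurable M"
    and \<kappa>: "continuous_conditional_law M T Y V \<kappa>" and \<kappa>': "continuous_conditional_law M T Y V \<kappa>'"
    and supp: "\<And>U. open U \<Longrightarrow> x \<in> U \<Longrightarrow> emeasure (distr M borel V) U \<noteq> 0"
    and g: "continuous_on UNIV g" "\<And>s. 0 \<le> g s" "\<And>s. g s \<le> C" and t: "range t \<subseteq> T"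
  shows "(\<integral>w. g (\<lambda>i. w (t i)) \<partial>\<kappa>' x) \<le> (\<integral>w. g (\<lambda>i. w (t i)) \<partial>\<kappa> x)"
proof (rule ccontr)
  assume neg: "\<not> ?thesis"
  interpret D: prob_space "distr M borel V" by (rule prob_space.prob_space_distr[OF M V])
  let ?g = "\<lambda>w. g (\<lambda>i. w (t i))"
  have mg: "?g \<in> borel_measurable (path_space T)" by (rule measurable_path_space_sequence[OF g(1) t])
  have bg: "bounded (range g)"
    unfolding bounded_iff using g(2,3) by (intro exI[of _ C]) auto
  note R = \<kappa>[unfolded continuous_conditional_law_def, THEN conjunct1]
  note R' = \<kappa>'[unfolded continuous_conditional_law_def, THEN conjunct1]
  define G where "G v = (\<integral>w. ?g w \<partial>\<kappa> v)" for v
  define G' where "G' v = (\<integral>w. ?g w \<partial>\<kappa>' v)" for v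
  have cG: "continuous_on UNIV G" "continuous_on UNIV G'"
    unfolding G_def G'_def using \<kappa> \<kappa>' g(1) bg t unfolding continuous_conditional_law_def by blast+
  have [measurable]: "G \<in> borel_measurable borel" "G' \<in> borel_measurable borel"
    using cG by (auto intro: borel_measurable_continuous_onI)
  have props: "0 \<le> (\<integral>w. ?g w \<partial>\<eta> v) \<and> (\<integral>w. ?g w \<partial>\<eta> v) \<le> C \<and> (\<integral>\<^sup>+w. ennreal (?g w) \<partial>\<eta> v) = ennreal (\<integral>w. ?g w \<partial>\<eta> v)"
    if \<eta>: "regular_conditional_law M T Y V \<eta>" for \<eta> v
  proof -
    interpret K: prob_space "\<eta> v" by (rule regular_conditional_lawD[OF \<eta>])
    have "?g \<in> borel_measurable (\<eta> v)"
      using mg by (simp add: measurable_cong_sets[OF regular_conditional_lawD(3)[OF \<eta>] refl])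
    then have "integrable (\<eta> v) ?g"
      by (rule K.integrable_const_bound[where B = C, rotated]) (use g in auto)
    then show ?thesis
      using g by (auto intro!: K.integral_ge_const K.integral_le_const nn_integral_eq_integral)
  qed
  have bnd: "0 \<le> G v" "G v \<le> C" "0 \<le> G' v" "G' v \<le> C" for v
    using props[OF R] props[OF R'] by (simp_all add: G_def G'_def)
  have C0: "0 \<le> C" using bnd(1,2) by (rule order_trans)
  define U where "U = {v. G v < G' v}"
  have oU: "open U" unfolding U_def using cG by (rule open_Collect_less)
  have [measurable]: "U \<in> sets borel" using oU by auto
  have xU: "x \<in> U" using neg by (simp add: U_def G_def G'_def)
  have int: "integrable (distr M borel V) (\<lambda>v. indicator U v * G v)" "integrable (distr M borel V) (\<lambda>v. indicator U v * G' v)"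
    using bnd by (auto intro!: D.integrable_const_bound[where B = C] simp: abs_mult indicator_def C0)
  have "(\<integral>\<^sup>+v. ennreal (indicator U v * G v) \<partial>distr M borel V) = (\<integral>\<^sup>+v. ennreal (indicator U v * G' v) \<partial>distr M borel V)"
    using regular_conditional_law_nn_integral_eq[OF R R' \<open>U \<in> sets borel\<close>, of "\<lambda>w. ennreal (?g w)"] mg props[OF R] props[OF R']
    by (simp add: G_def G'_def ennreal_mult ennreal_indicator)
  then have "(\<integral>v. indicator U v * G v \<partial>distr M borel V) = (\<integral>v. indicator U v * G' v \<partial>distr M borel V)"
    using bnd by (subst (1 2) integral_eq_nn_integral) auto
  then have "(\<integral>v. indicator U v * (G' v - G v) \<partial>distr M borel V) = 0"
    using int by (simp add: right_diff_distrib)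
  moreover have "integrable (distr M borel V) (\<lambda>v. indicator U v * (G' v - G v))"
    using int by (simp add: right_diff_distrib)
  ultimately have "AE v in distr M borel V. indicator U v * (G' v - G v) = 0"
    by (subst (asm) integral_nonneg_eq_0_iff_AE) (auto simp: U_def indicator_def)
  then have "AE v in distr M borel V. v \<notin> U"
    by eventually_elim (auto simp: U_def indicator_def split: if_splits)
  then have "emeasure (distr M borel V) U = 0"
    using AE_iff_null_sets[of U "distr M borel V"] by auto
  then show False using supp[OF oU xU] by simp
qed

text \<open>Adding \<open>C\<close> makes the test function nonnegative; the one-sided comparison is
  then used in both directions.\<close>

lemma continuous_conditional_law_integral_eq:
  fixes V :: "'a \<Rightarrow> 'v::topological_space" and g :: "(nat \<Rightarrow> real) \<Rightarrow> real"
  assumes M: "prob_space M" and V: "V \<in> borel_measurable M"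
    and \<kappa>: "continuous_conditional_law M T Y V \<kappa>" and \<kappa>': "continuous_conditional_law M T Y V \<kappa>'"
    and supp: "\<And>U. open U \<Longrightarrow> x \<in> U \<Longrightarrow> emeasure (distr M borel V) U \<noteq> 0"
    and g: "continuous_on UNIV g" "\<And>s. \<bar>g s\<bar> \<le> C" and t: "range t \<subseteq> T"
  shows "(\<integral>w. g (\<lambda>i. w (t i)) \<partial>\<kappa> x) = (\<integral>w. g (\<lambda>i. w (t i)) \<partial>\<kappa>' x)"
proof -
  let ?h = "\<lambda>s. g s + C"
  have h: "continuous_on UNIV ?h" "\<And>s. 0 \<le> ?h s" "\<And>s. ?h s \<le> 2 * C"
    using g by (auto intro!: continuous_intros simp: abs_le_iff) (smt (verit))+
  have "(\<integral>w. ?h (\<lambda>i. w (t i)) \<partial>\<kappa> x) = (\<integral>w. ?h (\<lambda>i. w (t i)) \<partial>\<kappa>' x)"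
    using continuous_conditional_law_integral_le[where x = x, OF M V \<kappa> \<kappa>' supp h t]
      continuous_conditional_law_integral_le[where x = x, OF M V \<kappa>' \<kappa> supp h t] by simp
  moreover have "(\<integral>w. ?h (\<lambda>i. w (t i)) \<partial>\<eta> x) = (\<integral>w. g (\<lambda>i. w (t i)) \<partial>\<eta> x) + C"
    if "continuous_conditional_law M T Y V \<eta>" for \<eta>
  proof -
    have R: "regular_conditional_law M T Y V \<eta>" using that by (simp add: continuous_conditional_law_def)
    interpret K: prob_space "\<eta> x" by (rule regular_conditional_lawD[OF R])
    have "(\<lambda>w. g (\<lambda>i. w (t i))) \<in> borel_measurable (\<eta> x)"
      using measurable_path_space_sequence[OF g(1) t]
      by (simp add: measurable_cong_sets[OF regular_conditional_lawD(3)[OF R] refl])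
    then have "integrable (\<eta> x) (\<lambda>w. g (\<lambda>i. w (t i)))"
      by (rule K.integrable_const_bound[where B = C, rotated]) (use g in auto)
    then show ?thesis by (simp add: K.prob_space)
  qed
  ultimately show ?thesis using \<kappa> \<kappa>' by simp
qed

text \<open>Cosine and sine of a finite linear combination of coordinates are bounded continuous
  test functions, and together they give the characteristic functions that
  \<open>cramer_wold\<close> compares.\<close>

lemma continuous_conditional_law_unique:
  fixes V :: "'a \<Rightarrow> 'v::topological_space"
  assumes M: "prob_space M" and V: "V \<in> borel_measurable M" and T: "T \<noteq> {}"
    and \<kappa>: "continuous_conditional_law M T Y V \<kappa>" and \<kappa>': "continuous_conditional_law M T Y V \<kappa>'"
    and supp: "\<And>U. open U \<Longrightarrow> x \<in> U \<Longrightarrow> emeasure (distr M borel V) U \<noteq> 0"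
  shows "\<kappa> x = \<kappa>' x"
proof -
  have R: "regular_conditional_law M T Y V \<kappa>" "regular_conditional_law M T Y V \<kappa>'"
    using \<kappa> \<kappa>' by (simp_all add: continuous_conditional_law_def)
  note D = regular_conditional_lawD[OF R(1)] and D' = regular_conditional_lawD[OF R(2)]
  have mt: "(\<lambda>w. w t) \<in> borel_measurable (\<kappa> x)" "(\<lambda>w. w t) \<in> borel_measurable (\<kappa>' x)" if "t \<in> T" for t
    using measurable_path_space_coordinate[OF that]
    by (simp_all add: measurable_cong_sets[OF D(3) refl] measurable_cong_sets[OF D'(3) refl])
  have "distr (\<kappa> x) (\<Pi>\<^sub>M t\<in>T. borel) (\<lambda>w. \<lambda>t\<in>T. w t) = distr (\<kappa>' x) (\<Pi>\<^sub>M t\<in>T. borel) (\<lambda>w. \<lambda>t\<in>T. w t)"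
  proof (rule cramer_wold[OF D(2) D'(2)])
    fix J and c :: "real \<Rightarrow> real" assume J: "finite J" "J \<subseteq> T"
    obtain h where h: "bij_betw h {0..<card J} J" using ex_bij_betw_nat_finite[OF J(1)] by blast
    obtain t0 where t0: "t0 \<in> T" using T by blast
    \<comment> \<open>Conditional laws are tested along infinite sequences of times, so the finite
      set \<open>J\<close> is listed first and padded with \<open>t0\<close>.\<close>
    define t where "t i = (if i < card J then h i else t0)" for i
    have t: "range t \<subseteq> T" using h J t0 by (auto simp: t_def bij_betw_def)
    have sum: "(\<Sum>j\<in>J. c j * w j) = (\<Sum>i<card J. c (h i) * w (t i))" for w :: "real \<Rightarrow> real"
      using sum.reindex_bij_betw[OF h, of "\<lambda>j. c j * w j"] by (simp add: t_def lessThan_atLeast0)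
    have cont: "continuous_on UNIV (\<lambda>s :: nat \<Rightarrow> real. \<Sum>i<card J. c (h i) * s i)"
      by (intro continuous_intros continuous_on_product_coordinates)
    have "(\<integral>w. cos (\<Sum>j\<in>J. c j * w j) \<partial>\<kappa> x) = (\<integral>w. cos (\<Sum>j\<in>J. c j * w j) \<partial>\<kappa>' x)"
      unfolding sum
      by (rule continuous_conditional_law_integral_eq[OF M V \<kappa> \<kappa>' supp _ _ t, where C = 1 and g = "\<lambda>s. cos (\<Sum>i<card J. c (h i) * s i)"])
        (auto intro!: continuous_intros cont)
    moreover have "(\<integral>w. sin (\<Sum>j\<in>J. c j * w j) \<partial>\<kappa> x) = (\<integral>w. sin (\<Sum>j\<in>J. c j * w j) \<partial>\<kappa>' x)"
      unfolding sum
      by (rule continuous_conditional_law_integral_eq[OF M V \<kappa> \<kappa>' supp _ _ t, where C = 1 and g = "\<lambda>s. sin (\<Sum>i<card J. c (h i) * s i)"])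
        (auto intro!: continuous_intros cont)
    moreover have "(\<lambda>w. \<Sum>j\<in>J. c j * w j) \<in> borel_measurable (\<kappa> x)" "(\<lambda>w. \<Sum>j\<in>J. c j * w j) \<in> borel_measurable (\<kappa>' x)"
      using J mt by (auto intro!: borel_measurable_sum borel_measurable_times)
    then have "integrable (\<kappa> x) (\<lambda>w. cis (\<Sum>j\<in>J. c j * w j))" "integrable (\<kappa>' x) (\<lambda>w. cis (\<Sum>j\<in>J. c j * w j))"
      by (auto intro!: prob_space_integrable_bounded[where C = 1] D D')
    ultimately show "(\<integral>w. cis (\<Sum>j\<in>J. c j * w j) \<partial>\<kappa> x) = (\<integral>w. cis (\<Sum>j\<in>J. c j * w j) \<partial>\<kappa>' x)"
      by (simp add: complex_eq_iff integral_Re[symmetric] integral_Im[symmetric])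
  qed (use mt in auto)
  \<comment> \<open>Elements of the path space are extensional, so restricting them to
    \<open>T\<close> changes nothing.\<close>
  moreover have restrict: "distr N (\<Pi>\<^sub>M t\<in>T. borel) (\<lambda>w. \<lambda>t\<in>T. w t) = distr N (\<Pi>\<^sub>M t\<in>T. borel) (\<lambda>w. w)"
    if "sets N = sets (path_space T)" for N :: "(real \<Rightarrow> real) measure"
  proof (rule distr_cong[OF refl refl])
    fix w assume "w \<in> space N"
    then have "w \<in> extensional T"
      using sets_eq_imp_space_eq[OF that] by (auto simp: path_space_def space_restrict_space space_PiM PiE_def)
    then show "(\<lambda>t\<in>T. w t) = w" by (rule extensional_restrict)
  qed
  ultimately have "distr (\<kappa> x) (\<Pi>\<^sub>M t\<in>T. borel) (\<lambda>w. w) = distr (\<kappa>' x) (\<Pi>\<^sub>M t\<in>T. borel) (\<lambda>w. w)"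
    by (simp only: restrict[OF D(3)] restrict[OF D'(3)])
  then show ?thesis
    by (rule path_space_measure_eqI[OF D(3) D'(3)])
qed

section \<open>Mixtures of independent processes\<close>

lemma gaussian_rvE:
  assumes "gaussian_rv M f"
  obtains (const) \<mu> where "AE \<omega> in M. f \<omega> = \<mu>"
    | (normal) \<mu> \<sigma> where "\<sigma> > 0" "distributed M lborel f (\<lambda>z. ennreal (normal_density \<mu> \<sigma> z))"
  using assms unfolding gaussian_rv_def by blast

lemma gaussian_rv_cong_AE:
  assumes f: "gaussian_rv M f" and g: "g \<in> borel_measurable M" and ae: "AE \<omega> in M. f \<omega> = g \<omega>"
  shows "gaussian_rv M g"
proof -
  have mf: "f \<in> borel_measurable M" using f by (simp add: gaussian_rv_def)
  have "distr M lborel f = distr M lborel g"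
    using mf g ae by (intro distr_cong_AE) auto
  then have "distributed M lborel g \<phi>" if "distributed M lborel f \<phi>" for \<phi>
    using that g by (simp add: distributed_def)
  moreover have "AE \<omega> in M. g \<omega> = \<mu>" if "AE \<omega> in M. f \<omega> = \<mu>" for \<mu>
    using that ae by eventually_elim simp
  ultimately show ?thesis using f g unfolding gaussian_rv_def by blast
qed

lemma gaussian_rv_add_const:
  assumes M: "prob_space M" and f: "gaussian_rv M f"
  shows "gaussian_rv M (\<lambda>\<omega>. \<mu> + f \<omega>)"
proof -
  interpret prob_space M by fact
  have m: "f \<in> borel_measurable M" using f by (simp add: gaussian_rv_def)
  consider (const) \<nu> where "AE \<omega> in M. f \<omega> = \<nu>"
    | (normal) \<nu> \<sigma> where "\<sigma> > 0" "distributed M lborel f (\<lambda>z. ennreal (normal_density \<nu> \<sigma> z))"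
    using f unfolding gaussian_rv_def by blast
  then show ?thesis
  proof cases
    case const
    then have "AE \<omega> in M. \<mu> + f \<omega> = \<mu> + \<nu>" by eventually_elim simp
    then show ?thesis unfolding gaussian_rv_def using m by (intro conjI disjI1 exI) auto
  next
    case normal
    then have "distributed M lborel (\<lambda>\<omega>. \<mu> + 1 * f \<omega>) (\<lambda>z. ennreal (normal_density (\<mu> + 1 * \<nu>) (\<bar>1\<bar> * \<sigma>) z))"
      by (intro normal_density_affine) auto
    then have "distributed M lborel (\<lambda>\<omega>. \<mu> + f \<omega>) (\<lambda>z. ennreal (normal_density (\<mu> + \<nu>) \<sigma> z))" by simp
    then show ?thesis unfolding gaussian_rv_def using m normal(1) by (intro conjI disjI2) auto
  qed
qed

text \<open>The convolution formula for normal densities needs two nondegenerate summands; if one of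
  them is almost surely constant, the sum is a translate of the other.\<close>

lemma gaussian_rv_add_indep:
  assumes M: "prob_space M" and ind: "prob_space.indep_var M borel f borel g"
    and f: "gaussian_rv M f" and g: "gaussian_rv M g"
  shows "gaussian_rv M (\<lambda>\<omega>. f \<omega> + g \<omega>)"
proof -
  interpret prob_space M by fact
  have m[measurable]: "f \<in> borel_measurable M" "g \<in> borel_measurable M" using f g by (simp_all add: gaussian_rv_def)
  consider (left) \<nu> where "AE \<omega> in M. f \<omega> = \<nu>" | (right) \<nu> where "AE \<omega> in M. g \<omega> = \<nu>"
    | (normal) \<mu> \<sigma> \<nu> \<rho> where "\<sigma> > 0" "distributed M lborel f (\<lambda>z. ennreal (normal_density \<mu> \<sigma> z))"
      "\<rho> > 0" "distributed M lborel g (\<lambda>z. ennreal (normal_density \<nu> \<rho> z))"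
    using gaussian_rvE[OF f] gaussian_rvE[OF g] by metis
  then show ?thesis
  proof cases
    case left
    then have "AE \<omega> in M. \<nu> + g \<omega> = f \<omega> + g \<omega>" by eventually_elim simp
    then show ?thesis by (rule gaussian_rv_cong_AE[OF gaussian_rv_add_const[OF M g], rotated]) simp
  next
    case right
    then have "AE \<omega> in M. \<nu> + f \<omega> = f \<omega> + g \<omega>" by eventually_elim simp
    then show ?thesis by (rule gaussian_rv_cong_AE[OF gaussian_rv_add_const[OF M f], rotated]) simp
  next
    case normal
    then have "0 < sqrt (\<sigma>\<^sup>2 + \<rho>\<^sup>2)" by (simp add: add_pos_pos)
    moreover have "distributed M lborel (\<lambda>\<omega>. f \<omega> + g \<omega>) (\<lambda>z. ennreal (normal_density (\<mu> + \<nu>) (sqrt (\<sigma>\<^sup>2 + \<rho>\<^sup>2)) z))"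
      using add_indep_normal[OF ind normal(1,3,2,4)] .
    moreover have "(\<lambda>\<omega>. f \<omega> + g \<omega>) \<in> borel_measurable M" by simp
    ultimately show ?thesis unfolding gaussian_rv_def by blast
  qed
qed

lemma gaussian_rv_sum_indep:
  assumes M: "prob_space M" and "finite I" and "prob_space.indep_vars M (\<lambda>_. borel) L I"
    and "\<And>i. i \<in> I \<Longrightarrow> gaussian_rv M (L i)"
  shows "gaussian_rv M (\<lambda>\<omega>. \<Sum>i\<in>I. L i \<omega>)"
  using assms(2-)
proof (induction I rule: finite_induct)
  case empty
  then show ?case by (auto simp: gaussian_rv_def)
next
  case (insert i I)
  interpret prob_space M by fact
  have "indep_vars (\<lambda>_. borel) L I" by (rule indep_vars_subset[OF insert.prems(1)]) auto
  then have "gaussian_rv M (\<lambda>\<omega>. \<Sum>i\<in>I. L i \<omega>)" using insert by auto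
  then have "gaussian_rv M (\<lambda>\<omega>. L i \<omega> + (\<Sum>i\<in>I. L i \<omega>))"
    using insert by (intro gaussian_rv_add_indep M indep_vars_sum) auto
  then show ?case using insert.hyps by simp
qed

text \<open>A nonzero variance excludes point masses, and a normal density is positive everywhere,
  so an open set of probability 0 would be Lebesgue null. This supplies the support of the
  conditioning vector.\<close>

lemma nondegenerate_gaussian_open:
  assumes M: "prob_space M" and f: "gaussian_rv M f" and mean: "integral\<^sup>L M f = 0"
    and var: "(\<integral>\<omega>. (f \<omega>)\<^sup>2 \<partial>M) \<noteq> 0" and A: "open A" "A \<noteq> {}"
  shows "emeasure M (f -` A \<inter> space M) \<noteq> 0"
proof -
  interpret prob_space M by fact
  have m[measurable]: "f \<in> borel_measurable M" using f by (simp add: gaussian_rv_def)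
  have mA[measurable]: "A \<in> sets borel" using A by simp
  consider (const) \<nu> where "AE \<omega> in M. f \<omega> = \<nu>"
    | (normal) \<nu> \<sigma> where "\<sigma> > 0" "distributed M lborel f (\<lambda>z. ennreal (normal_density \<nu> \<sigma> z))"
    using f unfolding gaussian_rv_def by blast
  then show ?thesis
  proof cases
    case const
    have "integral\<^sup>L M f = (\<integral>\<omega>. \<nu> \<partial>M)" by (rule integral_cong_AE) (use const in auto)
    moreover have "(\<integral>\<omega>. (f \<omega>)\<^sup>2 \<partial>M) = (\<integral>\<omega>. \<nu>\<^sup>2 \<partial>M)" by (rule integral_cong_AE) (use const in auto)
    ultimately show ?thesis using mean var by (simp add: prob_space)
  next
    case normal
    show ?thesis
    proof
      assume "emeasure M (f -` A \<inter> space M) = 0"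
      then have "(\<integral>\<^sup>+z. ennreal (normal_density \<nu> \<sigma> z) * indicator A z \<partial>lborel) = 0"
        using distributed_emeasure[OF normal(2), of A] by simp
      then have "AE z in lborel. ennreal (normal_density \<nu> \<sigma> z) * indicator A z = 0"
        by (subst (asm) nn_integral_0_iff_AE) auto
      then have "AE z in lborel. z \<notin> A"
      proof eventually_elim
        case (elim z)
        then show ?case
          using normal_density_pos[OF normal(1), of \<nu> z] by (auto simp: indicator_def split: if_splits)
      qed
      then have "A \<in> null_sets lborel" using AE_iff_null_sets[of A lborel] by simp
      then have "negligible A" by (simp add: negligible_iff_null_sets null_sets_completionI)
      then show False using open_not_negligible A by blast
    qed
  qed
qed

lemma measurable_vec_lambda:
  "(\<lambda>p. \<chi> i. p i) \<in> measurable (\<Pi>\<^sub>M i\<in>(UNIV :: 'k::finite set). borel) (borel :: (real ^ 'k) measure)"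
proof (subst borel_measurable_euclidean_space, intro ballI)
  fix b :: "real ^ 'k" assume "b \<in> Basis"
  then obtain i where b: "b = axis i 1" by (auto simp: Basis_vec_def)
  show "(\<lambda>p. (\<chi> i. p i) \<bullet> b) \<in> borel_measurable (\<Pi>\<^sub>M i\<in>UNIV. borel)"
    unfolding b inner_axis by simp
qed

lemma gaussian_space_integral_bilinear:
  assumes G: "gaussian_space M G" and f: "f \<in> G" "f' \<in> G" and g: "g \<in> G" "g' \<in> G"
  shows "(\<integral>\<omega>. (f \<omega> + a * f' \<omega>) * (g \<omega> + b * g' \<omega>) \<partial>M) =
    (\<integral>\<omega>. f \<omega> * g \<omega> \<partial>M) + a * (\<integral>\<omega>. f' \<omega> * g \<omega> \<partial>M) + b * (\<integral>\<omega>. f \<omega> * g' \<omega> \<partial>M) + a * b * (\<integral>\<omega>. f' \<omega> * g' \<omega> \<partial>M)"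
proof -
  note I = gaussian_space_integrable_mult[OF G]
  have "(\<integral>\<omega>. (f \<omega> + a * f' \<omega>) * (g \<omega> + b * g' \<omega>) \<partial>M) =
      (\<integral>\<omega>. f \<omega> * g \<omega> + a * (f' \<omega> * g \<omega>) + b * (f \<omega> * g' \<omega>) + a * b * (f' \<omega> * g' \<omega>) \<partial>M)"
    by (intro Bochner_Integration.integral_cong) (auto simp: algebra_simps)
  also have "\<dots> = (\<integral>\<omega>. f \<omega> * g \<omega> \<partial>M) + a * (\<integral>\<omega>. f' \<omega> * g \<omega> \<partial>M) + b * (\<integral>\<omega>. f \<omega> * g' \<omega> \<partial>M) + a * b * (\<integral>\<omega>. f' \<omega> * g' \<omega> \<partial>M)"
    using I[OF f(1) g(1)] I[OF f(2) g(1)] I[OF f(1) g(2)] I[OF f(2) g(2)] by simp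
  finally show ?thesis .
qed

text \<open>The left side is the bilinear expansion of the covariance of two residuals, with the
  values s (theta - tau t) filled in.\<close>

lemma residual_covariance_identity:
  fixes c \<theta> \<tau> u h h' :: real
  assumes "c * (\<theta> - \<tau> * u) = \<tau>"
  shows "(u + h) * (\<theta> - \<tau> * (u + h')) + (h * c - 1) * (u * (\<theta> - \<tau> * (u + h'))) +
      (h' * c - 1) * (u * (\<theta> - \<tau> * (u + h))) + (h * c - 1) * (h' * c - 1) * (u * (\<theta> - \<tau> * u)) =
    h * (\<theta> - \<theta> * c * h')" (is "?l = ?r")
proof -
  \<comment> \<open>The difference is a multiple of the defect in the equation assumed for
    \<open>c\<close>.\<close>
  have "?l - ?r = h * h' * (1 + u * c) * (c * (\<theta> - \<tau> * u) - \<tau>)" by (simp add: algebra_simps)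
  then show ?thesis using assms by simp
qed

section \<open>The residual process and its covariance\<close>

locale gmsi_mixture =
  fixes M :: "'a measure" and X :: "'k::finite \<Rightarrow> real \<Rightarrow> 'a \<Rightarrow> real"
    and \<theta> \<tau> k :: "'k \<Rightarrow> real" and \<Delta> :: ereal and u :: real
  assumes gmsi: "gmsi_process M (X i) (\<theta> i) (\<tau> i) \<Delta>"
    and \<tau>_nz: "\<tau> i \<noteq> 0"
    and indep: "prob_space.indep_vars M (\<lambda>i. \<Pi>\<^sub>M t\<in>time_interval \<Delta>. borel)
      (\<lambda>i. path_map (time_interval \<Delta>) (X i)) UNIV"
    and k_nz: "\<exists>i. k i \<noteq> 0"
    and u: "0 \<le> u" "ereal u < \<Delta>"
begin

abbreviation "T \<equiv> time_interval \<Delta>"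
abbreviation "T' \<equiv> time_interval (\<Delta> - ereal u)"

definition "c i = 1 / (\<theta> i / \<tau> i - u)"

text \<open>Minus \<open>h * c i\<close> is the regression coefficient of \<open>X i (u + h) - X i u\<close> on
  \<open>X i u\<close>.\<close>

definition "R i h \<omega> = X i (u + h) \<omega> + (h * c i - 1) * X i u \<omega>"

definition "Z h \<omega> = (\<Sum>i\<in>UNIV. k i * R i h \<omega>)"

text \<open>A single span over all pairs of component and time, so that different components are
  jointly Gaussian as well.\<close>

definition "G = lin_span (UNIV \<times> T) (\<lambda>(i, t). X i t)"

lemma gmsiD:
  shows "0 < \<Delta>" "0 < \<theta> i" "ereal (\<tau> i) \<le> ereal (\<theta> i) / \<Delta>" "prob_space M"
    and "t \<in> T \<Longrightarrow> X i t \<in> borel_measurable M"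
    and "\<omega> \<in> space M \<Longrightarrow> continuous_on T (\<lambda>t. X i t \<omega>)"
    and "AE \<omega> in M. X i 0 \<omega> = 0"
    and "t \<in> T \<Longrightarrow> integral\<^sup>L M (X i t) = 0"
    and "gaussian_process M T (X i)"
    and "s \<in> T \<Longrightarrow> t \<in> T \<Longrightarrow> s \<le> t \<Longrightarrow> (\<integral>\<omega>. X i s \<omega> * X i t \<omega> \<partial>M) = s * (\<theta> i - \<tau> i * t)"
  using gmsi[of i] unfolding gmsi_process_def Let_def by blast+

sublocale prob_space M by (rule gmsiD)

lemma uT: "u \<in> T" using u by (simp add: time_interval_def)

lemma zero_T': "0 \<in> T'"
  using u by (cases \<Delta>) (auto simp: time_interval_def)

lemma T'D: "h \<in> T' \<Longrightarrow> 0 \<le> h" "h \<in> T' \<Longrightarrow> u + h \<in> T"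
  using u by (cases \<Delta>; auto simp: time_interval_def)+

lemma pos_u: "\<tau> i * u < \<theta> i"
  by (rule time_interval_less[OF gmsiD(2,3,1) uT])

text \<open>\<open>pos_u\<close> and \<open>\<tau>_nz\<close> keep the denominators away from 0. The
  covariance computations use \<open>c\<close> through this equation.\<close>

lemma c_eq: "c i * (\<theta> i - \<tau> i * u) = \<tau> i"
  using pos_u[of i] \<tau>_nz[of i] by (simp add: c_def field_simps)

lemma weight_nonneg: "0 \<le> (k i)\<^sup>2 * \<theta> i"
  using gmsiD(2)[of i] by simp

text \<open>Subtracting tau_i u from tau_i Delta <= theta_i gives tau_i (Delta - u) <= theta_i -
  tau_i u. For infinite Delta the hypothesis says tau_i <= 0, hence c_i <= 0.\<close>

lemma c_le: "ereal (c i) \<le> 1 / (\<Delta> - ereal u)"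
proof -
  have c: "c i = \<tau> i / (\<theta> i - \<tau> i * u)" using c_eq[of i] pos_u[of i] by (simp add: field_simps)
  show ?thesis
  proof (cases \<Delta>)
    case (real d)
    then have d: "u < d" "0 < d" "\<tau> i \<le> \<theta> i / d" using u gmsiD(1) gmsiD(3)[of i] by auto
    then have "\<tau> i * (d - u) \<le> 1 * (\<theta> i - \<tau> i * u)" by (simp add: field_simps)
    then have "c i \<le> 1 / (d - u)" using pos_u[of i] d unfolding c by (simp add: field_simps)
    then show ?thesis using real d by (simp add: one_ereal_def)
  next
    case PInf
    then have "\<tau> i \<le> 0" using gmsiD(3)[of i] by simp
    then have "c i \<le> 0" using pos_u[of i] unfolding c by (simp add: divide_nonpos_pos)
    then show ?thesis using PInf by simp
  qed (use u in simp)
qed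

lemma base_G: "t \<in> T \<Longrightarrow> X i t \<in> G"
  using lin_span_base[of "(i, t)" "UNIV \<times> T" "\<lambda>(i, t). X i t"] by (simp add: G_def)

text \<open>A combination over pairs is grouped by component: each group is Gaussian because its
  process is, and the groups are independent as functions of independent paths.\<close>

lemma gaussian_G: "gaussian_space M G"
  unfolding G_def
proof (rule gaussian_space_lin_span[OF prob_space_axioms])
  fix J :: "('k \<times> real) set" and a assume J: "finite J" "J \<subseteq> UNIV \<times> T"
  define S where "S i = {t. (i, t) \<in> J}" for i
  have S: "finite (S i)" "S i \<subseteq> T" for i
    using J(1) finite_vimageI[of J "Pair i"] J(2) by (auto simp: S_def vimage_def inj_on_def)
  define L where "L i \<omega> = (\<Sum>t\<in>S i. a (i, t) * X i t \<omega>)" for i \<omega>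
  have "gaussian_rv M (L i)" for i
    using gmsiD(9)[of i, unfolded gaussian_process_def, rule_format, of "S i" "\<lambda>t. a (i, t)"] S[of i]
    by (simp add: L_def[abs_def])
  moreover have "indep_vars (\<lambda>_. borel) L UNIV"
  proof -
    have "indep_vars (\<lambda>_. borel) (\<lambda>i \<omega>. \<Sum>t\<in>S i. a (i, t) * path_map T (X i) \<omega> t) UNIV"
      using S by (intro indep_vars_compose2[OF indep] borel_measurable_sum borel_measurable_times measurable_component_singleton) auto
    also have "(\<lambda>i \<omega>. \<Sum>t\<in>S i. a (i, t) * path_map T (X i) \<omega> t) = L"
      using S unfolding L_def path_map_def by (intro ext sum.cong) auto
    finally show ?thesis .
  qed
  ultimately have "gaussian_rv M (\<lambda>\<omega>. \<Sum>i\<in>UNIV. L i \<omega>)"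
    by (intro gaussian_rv_sum_indep[OF prob_space_axioms]) auto
  moreover have "(\<Sum>i\<in>UNIV. L i \<omega>) = (\<Sum>j\<in>J. a j * (case j of (i, t) \<Rightarrow> X i t) \<omega>)" for \<omega>
  proof -
    have "J = Sigma UNIV S" by (auto simp: S_def)
    then show ?thesis
      unfolding L_def using S by (subst sum.Sigma) (auto intro!: sum.cong)
  qed
  ultimately show "gaussian_rv M (\<lambda>\<omega>. \<Sum>j\<in>J. a j * (case j of (i, t) \<Rightarrow> X i t) \<omega>)" by simp
qed (auto simp: gmsiD(8))

lemma cross_covariance:
  assumes "s \<in> T" "t \<in> T" "i \<noteq> j"
  shows "(\<integral>\<omega>. X i s \<omega> * X j t \<omega> \<partial>M) = 0"
proof -
  \<comment> \<open>One time is assigned to each component, so that the chosen values form a family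
    of functions of the independent paths.\<close>
  define r where "r l = (if l = i then s else t)" for l
  have r: "r l \<in> T" for l using assms by (simp add: r_def)
  have "indep_vars (\<lambda>_. borel) (\<lambda>l \<omega>. path_map T (X l) \<omega> (r l)) UNIV"
    using r by (intro indep_vars_compose2[OF indep] measurable_component_singleton) auto
  then have "indep_vars (\<lambda>_. borel) (\<lambda>l \<omega>. X l (r l) \<omega>) {i, j}"
    using r by (simp add: path_map_def indep_vars_subset[of _ _ UNIV])
  then have "(\<integral>\<omega>. (\<Prod>l\<in>{i, j}. X l (r l) \<omega>) \<partial>M) = (\<Prod>l\<in>{i, j}. \<integral>\<omega>. X l (r l) \<omega> \<partial>M)"
    by (intro indep_vars_lebesgue_integral gaussian_space_integrable(1)[OF gaussian_G] base_G r) auto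
  then show ?thesis using assms gmsiD(8)[OF assms(1), of i] by (simp add: r_def)
qed

lemma R_G: "h \<in> T' \<Longrightarrow> R i h \<in> G"
  using lin_span_add[of "X i (u + h)" "UNIV \<times> T" "\<lambda>(i, t). X i t" "X i u" "h * c i - 1"] T'D(2) base_G uT
  unfolding R_def[abs_def] G_def by auto

lemma Z_G: "h \<in> T' \<Longrightarrow> Z h \<in> G"
  unfolding Z_def[abs_def] by (intro gaussian_space_sum[OF gaussian_G] R_G) auto

lemma R_covariance_same:
  assumes h: "h \<in> T'" "h' \<in> T'" "h \<le> h'"
  shows "(\<integral>\<omega>. R i h \<omega> * R i h' \<omega> \<partial>M) = h * (\<theta> i - \<theta> i * c i * h')"
proof -
  have le: "u \<le> u + h" "u \<le> u + h'" "u + h \<le> u + h'" using T'D(1) h by auto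
  note T = uT T'D(2)[OF h(1)] T'D(2)[OF h(2)]
  have cov_sym: "(\<integral>\<omega>. X i (u + h) \<omega> * X i u \<omega> \<partial>M) = u * (\<theta> i - \<tau> i * (u + h))"
    using gmsiD(10)[OF T(1,2) le(1), of i] by (simp only: mult.commute[of "X i (u + h) _"])
  have "(\<integral>\<omega>. R i h \<omega> * R i h' \<omega> \<partial>M) = (u + h) * (\<theta> i - \<tau> i * (u + h'))
      + (h * c i - 1) * (u * (\<theta> i - \<tau> i * (u + h'))) + (h' * c i - 1) * (u * (\<theta> i - \<tau> i * (u + h)))
      + (h * c i - 1) * (h' * c i - 1) * (u * (\<theta> i - \<tau> i * u))"
    unfolding R_def gaussian_space_integral_bilinear[OF gaussian_G base_G[OF T(2)] base_G[OF T(1)] base_G[OF T(3)] base_G[OF T(1)]]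
    by (simp only: gmsiD(10)[OF T(2,3) le(3)] gmsiD(10)[OF T(1,3) le(2)] gmsiD(10)[OF T(1,1) order_refl] cov_sym)
  also have "\<dots> = h * (\<theta> i - \<theta> i * c i * h')"
    by (rule residual_covariance_identity[OF c_eq])
  finally show ?thesis .
qed

lemma R_covariance_cross:
  assumes h: "h \<in> T'" "h' \<in> T'" "i \<noteq> j"
  shows "(\<integral>\<omega>. R i h \<omega> * R j h' \<omega> \<partial>M) = 0"
proof -
  note T = uT T'D(2)[OF h(1)] T'D(2)[OF h(2)]
  show ?thesis unfolding R_def
    by (subst gaussian_space_integral_bilinear[OF gaussian_G]) (use T base_G h in \<open>auto simp: cross_covariance\<close>)
qed

text \<open>For \<open>i = j\<close> the covariance is \<open>h * u\<close> times the defect of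
  \<open>c_eq\<close>; for \<open>i \<noteq> j\<close> both terms vanish by independence.\<close>

lemma R_uncorrelated:
  assumes h: "h \<in> T'"
  shows "(\<integral>\<omega>. X j u \<omega> * R i h \<omega> \<partial>M) = 0"
proof -
  note T = uT T'D(2)[OF h]
  have e: "(\<integral>\<omega>. X j u \<omega> * R i h \<omega> \<partial>M) = (\<integral>\<omega>. X j u \<omega> * X i (u + h) \<omega> \<partial>M) + (h * c i - 1) * (\<integral>\<omega>. X j u \<omega> * X i u \<omega> \<partial>M)"
    using gaussian_space_integral_bilinear[OF gaussian_G base_G[OF uT] base_G[OF uT] base_G[OF T(2)] base_G[OF uT], of j 0 j i "h * c i - 1" i]
    by (simp add: R_def)
  show ?thesis
  proof (cases "i = j")
    case True
    have "(\<integral>\<omega>. X j u \<omega> * R i h \<omega> \<partial>M) = u * (\<theta> i - \<tau> i * (u + h)) + (h * c i - 1) * (u * (\<theta> i - \<tau> i * u))"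
      unfolding e using gmsiD(10)[OF T, of i] gmsiD(10)[OF uT uT, of i] T'D(1)[OF h] True by simp
    also have "\<dots> = h * u * (c i * (\<theta> i - \<tau> i * u) - \<tau> i)" by (simp add: algebra_simps)
    also have "\<dots> = 0" using c_eq[of i] by simp
    finally show ?thesis .
  next
    case False
    then show ?thesis unfolding e using cross_covariance T by auto
  qed
qed

lemma Z_uncorrelated:
  assumes h: "h \<in> T'"
  shows "(\<integral>\<omega>. X j u \<omega> * Z h \<omega> \<partial>M) = 0"
  using gaussian_space_integral_sum_mult_sum[OF gaussian_G, of "{j}" UNIV "\<lambda>j. X j u" "\<lambda>i. R i h" "\<lambda>_. 1" k] uT R_G[OF h]
  by (simp add: Z_def base_G R_uncorrelated[OF h])

lemma Z_covariance:
  assumes h: "h \<in> T'" "h' \<in> T'" "h \<le> h'"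
  shows "(\<integral>\<omega>. Z h \<omega> * Z h' \<omega> \<partial>M) =
    h * ((\<Sum>i\<in>UNIV. (k i)\<^sup>2 * \<theta> i) - (\<Sum>i\<in>UNIV. (k i)\<^sup>2 * (\<theta> i / (\<theta> i / \<tau> i - u))) * h')"
proof -
  have "(\<integral>\<omega>. Z h \<omega> * Z h' \<omega> \<partial>M) = (\<Sum>i\<in>UNIV. \<Sum>j\<in>UNIV. k i * k j * (\<integral>\<omega>. R i h \<omega> * R j h' \<omega> \<partial>M))"
    unfolding Z_def by (rule gaussian_space_integral_sum_mult_sum[OF gaussian_G]) (use R_G h in auto)
  \<comment> \<open>Residuals of different components are uncorrelated, so only the diagonal
    survives.\<close>
  also have "\<dots> = (\<Sum>i\<in>UNIV. \<Sum>j\<in>UNIV. if i = j then k i * k i * (h * (\<theta> i - \<theta> i * c i * h')) else 0)"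
    using h by (intro sum.cong refl) (auto simp: R_covariance_same R_covariance_cross)
  also have "\<dots> = h * ((\<Sum>i\<in>UNIV. (k i)\<^sup>2 * \<theta> i) - (\<Sum>i\<in>UNIV. (k i)\<^sup>2 * (\<theta> i * c i)) * h')"
    by (simp add: sum_distrib_left sum_distrib_right sum_subtractf right_diff_distrib power2_eq_square mult_ac)
  finally show ?thesis by (simp add: c_def)
qed

lemma Z_measurable: "h \<in> T' \<Longrightarrow> Z h \<in> borel_measurable M"
  by (rule gaussian_space_measurable[OF gaussian_G Z_G])

lemma Z_continuous: "\<omega> \<in> space M \<Longrightarrow> continuous_on T' (\<lambda>h. Z h \<omega>)"
  unfolding Z_def R_def
  by (intro continuous_intros continuous_on_compose2[OF gmsiD(6)]) (auto intro: T'D)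

lemma Z_measurable_path: "path_map T' Z \<in> measurable M (\<Pi>\<^sub>M h\<in>T'. borel)"
  unfolding path_map_def[abs_def] by (intro measurable_restrict Z_measurable)

section \<open>The conditioning vector and the conditional kernel\<close>

definition "V \<omega> = (\<chi> i. X i u \<omega>)" for \<omega>

lemma V_measurable: "V \<in> borel_measurable M"
proof -
  have "(\<lambda>\<omega>. \<lambda>i\<in>UNIV. X i u \<omega>) \<in> measurable M (\<Pi>\<^sub>M i\<in>(UNIV::'k set). borel)"
    by (intro measurable_restrict gmsiD uT)
  from measurable_compose[OF this measurable_vec_lambda] show ?thesis
    by (simp add: V_def[abs_def])
qed

text \<open>All \<open>X i u\<close> and \<open>Z h\<close> lie in the Gaussian space
  \<open>G\<close>, so vanishing covariances make the vector independent of the whole path of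
  \<open>Z\<close>.\<close>

lemma V_Z_product: "distr M (borel \<Otimes>\<^sub>M (\<Pi>\<^sub>M h\<in>T'. borel)) (\<lambda>\<omega>. (V \<omega>, path_map T' Z \<omega>)) =
    distr M borel V \<Otimes>\<^sub>M distr M (\<Pi>\<^sub>M h\<in>T'. borel) (path_map T' Z)"
proof -
  have m: "(\<lambda>\<omega>. \<lambda>i\<in>UNIV. X i u \<omega>) \<in> measurable M (\<Pi>\<^sub>M i\<in>(UNIV::'k set). borel)"
    by (intro measurable_restrict gmsiD uT)
  have "distr M ((\<Pi>\<^sub>M i\<in>(UNIV::'k set). borel) \<Otimes>\<^sub>M (\<Pi>\<^sub>M h\<in>T'. borel)) (\<lambda>\<omega>. (\<lambda>i\<in>UNIV. X i u \<omega>, \<lambda>h\<in>T'. Z h \<omega>)) =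
      distr M (\<Pi>\<^sub>M i\<in>UNIV. borel) (\<lambda>\<omega>. \<lambda>i\<in>UNIV. X i u \<omega>) \<Otimes>\<^sub>M distr M (\<Pi>\<^sub>M h\<in>T'. borel) (\<lambda>\<omega>. \<lambda>h\<in>T'. Z h \<omega>)"
    by (rule gaussian_uncorrelated_indep[OF gaussian_G]) (use base_G uT Z_G Z_uncorrelated in auto)
  from distr_pair_product_map[OF prob_space_axioms m Z_measurable_path[unfolded path_map_def[abs_def]] this
      measurable_vec_lambda, of "\<lambda>w. w" "\<Pi>\<^sub>M h\<in>T'. borel"]
  show ?thesis by (simp add: V_def[abs_def] path_map_def[abs_def])
qed

text \<open>\<open>a\<close> is kept as a parameter: its measurability is enough for a regular
  conditional law, its continuity for the weakly continuous version.\<close>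

definition kernel :: "(real ^ 'k \<Rightarrow> real) \<Rightarrow> real ^ 'k \<Rightarrow> (real \<Rightarrow> real) measure" where
  "kernel a v = distr M (path_space T') (path_map T' (\<lambda>h \<omega>. Z h \<omega> + h * a v))"

lemma shifted_path_measurable: "path_map T' (\<lambda>h \<omega>. Z h \<omega> + h * b) \<in> measurable M (path_space T')"
  using Z_measurable Z_continuous by (intro measurable_path_map) (auto intro!: continuous_intros)

lemma kernel_measurable:
  assumes [measurable]: "a \<in> borel_measurable borel"
  shows "kernel a \<in> measurable borel (prob_algebra (path_space T'))"
  unfolding kernel_def[abs_def]
proof (rule measurable_distr_prob_space2)
  show "(\<lambda>_. M) \<in> measurable borel (prob_algebra M)"
    by (rule measurable_const) (simp add: space_prob_algebra prob_space_axioms)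
  \<comment> \<open>Measurability in the kernel's argument needs joint measurability of the shifted
    path; this is checked coordinatewise, and continuity of paths then puts the map into the path
    space.\<close>
  have "(\<lambda>p. \<lambda>h\<in>T'. Z h (snd p) + h * a (fst p)) \<in> measurable (borel \<Otimes>\<^sub>M M) (\<Pi>\<^sub>M h\<in>T'. borel)"
  proof (rule measurable_restrict)
    fix h assume "h \<in> T'"
    then have [measurable]: "Z h \<in> borel_measurable M" by (rule Z_measurable)
    show "(\<lambda>p. Z h (snd p) + h * a (fst p)) \<in> borel_measurable (borel \<Otimes>\<^sub>M M)" by measurable
  qed
  then have "(\<lambda>p. \<lambda>h\<in>T'. Z h (snd p) + h * a (fst p)) \<in> measurable (borel \<Otimes>\<^sub>M M) (path_space T')"
    by (rule measurable_path_space_into)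
      (auto simp: continuous_on_restrict_iff space_pair_measure intro!: continuous_intros Z_continuous)
  then show "(\<lambda>(v, \<omega>). path_map T' (\<lambda>h \<omega>. Z h \<omega> + h * a v) \<omega>) \<in> measurable (borel \<Otimes>\<^sub>M M) (path_space T')"
    by (simp add: path_map_def case_prod_unfold)
qed

text \<open>The joint law of \<open>V\<close> and \<open>Z\<close> is a product, and slicing it at
  \<open>v\<close> freezes the drift at \<open>h * a v\<close>. A path event \<open>B\<close> is
  only a trace, so the computation runs with a product set \<open>B'\<close>; continuity of every
  path makes the two agree.\<close>

lemma kernel_regular:
  assumes a[measurable]: "a \<in> borel_measurable borel" and Y: "\<And>h \<omega>. h \<in> T' \<Longrightarrow> Y h \<omega> = Z h \<omega> + h * a (V \<omega>)"
  shows "regular_conditional_law M T' Y V (kernel a)"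
  unfolding regular_conditional_law_def
proof (intro conjI ballI kernel_measurable a)
  fix A :: "(real ^ 'k) set" and B assume A[measurable]: "A \<in> sets borel" and B: "B \<in> sets (path_space T')"
  then obtain B' where B'[measurable]: "B' \<in> sets (\<Pi>\<^sub>M h\<in>T'. borel)" and BB: "B = {w. continuous_on T' w} \<inter> B'"
    unfolding path_space_def sets_restrict_space by blast
  let ?P = "\<Pi>\<^sub>M h\<in>T'. (borel :: real measure)"
  let ?s = "\<lambda>v w. \<lambda>h\<in>T'. w h + h * a v"
  \<comment> \<open>The event about \<open>V\<close> and \<open>Y\<close>, rewritten as an event
    about the independent pair \<open>V\<close> and \<open>Z\<close>.\<close>
  define S where "S = {p \<in> space (borel \<Otimes>\<^sub>M ?P). fst p \<in> A \<and> ?s (fst p) (snd p) \<in> B'}"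
  have "(\<lambda>p. ?s (fst p) (snd p)) \<in> measurable (borel \<Otimes>\<^sub>M ?P) ?P"
  proof (rule measurable_restrict)
    fix h assume "h \<in> T'"
    then have [measurable]: "(\<lambda>w. w h) \<in> borel_measurable ?P" by (rule measurable_component_singleton)
    show "(\<lambda>p. snd p h + h * a (fst p)) \<in> borel_measurable (borel \<Otimes>\<^sub>M ?P)" by measurable
  qed
  note [measurable] = this
  have S: "S \<in> sets (borel \<Otimes>\<^sub>M ?P)" unfolding S_def by measurable
  have VZ: "(\<lambda>\<omega>. (V \<omega>, path_map T' Z \<omega>)) \<in> measurable M (borel \<Otimes>\<^sub>M ?P)"
    using V_measurable Z_measurable_path by (rule measurable_Pair)
  have pZ: "path_map T' Z \<omega> \<in> space ?P" if "\<omega> \<in> space M" for \<omega>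
    using Z_measurable_path that by (rule measurable_space)
  have shift: "?s v (path_map T' Z \<omega>) = path_map T' (\<lambda>h \<omega>. Z h \<omega> + h * a v) \<omega>" for v \<omega>
    by (auto simp: path_map_def)
  have cont: "continuous_on T' (path_map T' (\<lambda>h \<omega>. Z h \<omega> + h * b) \<omega>)" if "\<omega> \<in> space M" for b \<omega>
    unfolding path_map_def continuous_on_restrict_iff using that by (intro continuous_intros Z_continuous)
  have contY: "continuous_on T' (path_map T' Y \<omega>)" if "\<omega> \<in> space M" for \<omega>
    using cont[OF that, of "a (V \<omega>)"] by (simp add: path_map_def Y cong: restrict_cong)
  interpret DZ: prob_space "distr M ?P (path_map T' Z)" by (rule prob_space_distr[OF Z_measurable_path])
  have "emeasure M {\<omega>\<in>space M. V \<omega> \<in> A \<and> path_map T' Y \<omega> \<in> B} = emeasure (distr M (borel \<Otimes>\<^sub>M ?P) (\<lambda>\<omega>. (V \<omega>, path_map T' Z \<omega>))) S"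
    unfolding emeasure_distr[OF VZ S]
    using pZ contY by (intro arg_cong[where f = "emeasure M"])
      (auto simp: S_def BB space_pair_measure shift path_map_def Y cong: restrict_cong)
  also have "\<dots> = (\<integral>\<^sup>+v. emeasure (distr M ?P (path_map T' Z)) (Pair v -` S) \<partial>distr M borel V)"
    unfolding V_Z_product using S
    by (intro DZ.emeasure_pair_measure_alt) (simp cong: sets_pair_measure_cong)
  also have "\<dots> = (\<integral>\<^sup>+v\<in>A. emeasure (kernel a v) B \<partial>distr M borel V)"
  proof (rule nn_integral_cong)
    fix v :: "real ^ 'k"
    have "emeasure (distr M ?P (path_map T' Z)) (Pair v -` S) = emeasure M (path_map T' Z -` (Pair v -` S) \<inter> space M)"
      using sets_Pair1[OF S] by (intro emeasure_distr Z_measurable_path)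
    also have "\<dots> = emeasure M (if v \<in> A then path_map T' (\<lambda>h \<omega>. Z h \<omega> + h * a v) -` B \<inter> space M else {})"
      using pZ cont by (intro arg_cong[where f = "emeasure M"]) (auto simp: S_def BB space_pair_measure shift)
    also have "\<dots> = emeasure (kernel a v) B * indicator A v"
      unfolding kernel_def emeasure_distr[OF shifted_path_measurable B] by simp
    finally show "emeasure (distr M ?P (path_map T' Z)) (Pair v -` S) = emeasure (kernel a v) B * indicator A v" .
  qed
  finally show "emeasure M {\<omega>\<in>space M. V \<omega> \<in> A \<and> path_map T' Y \<omega> \<in> B} = (\<integral>\<^sup>+v\<in>A. emeasure (kernel a v) B \<partial>distr M borel V)" .
qed

text \<open>All kernels are image laws of the same \<open>M\<close>, so \<open>v\<close> enters only
  through a continuous shift of the argument of \<open>g\<close>; boundedness of \<open>g\<close>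
  gives dominated convergence.\<close>

lemma kernel_continuous:
  assumes a: "continuous_on UNIV a" and Y: "\<And>h \<omega>. h \<in> T' \<Longrightarrow> Y h \<omega> = Z h \<omega> + h * a (V \<omega>)"
  shows "continuous_conditional_law M T' Y V (kernel a)"
  unfolding continuous_conditional_law_def
proof (intro conjI allI impI kernel_regular Y)
  show "a \<in> borel_measurable borel" using a by (rule borel_measurable_continuous_onI)
  fix t :: "nat \<Rightarrow> real" and g :: "(nat \<Rightarrow> real) \<Rightarrow> real"
  assume tg: "range t \<subseteq> T' \<and> continuous_on UNIV g \<and> bounded (range g)"
  then obtain C where C: "\<And>s. \<bar>g s\<bar> \<le> C" by (auto simp: bounded_iff)
  have t: "t i \<in> T'" for i using tg by auto
  have gm: "(\<lambda>w. g (\<lambda>i. w (t i))) \<in> borel_measurable (path_space T')"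
    using tg by (intro measurable_path_space_sequence) auto
  have eq: "(\<integral>w. g (\<lambda>i. w (t i)) \<partial>kernel a v) = (\<integral>\<omega>. g (\<lambda>i. Z (t i) \<omega> + t i * a v) \<partial>M)" for v
    unfolding kernel_def
    by (subst integral_distr[OF shifted_path_measurable gm]) (simp add: path_map_def t)
  have gZ: "(\<lambda>\<omega>. g (\<lambda>i. Z (t i) \<omega> + t i * a v)) \<in> borel_measurable M" for v
    using measurable_compose[OF shifted_path_measurable gm, of "a v"] by (simp add: path_map_def t)
  have gc: "continuous_on UNIV (\<lambda>v. g (\<lambda>i. Z (t i) \<omega> + t i * a v))" for \<omega>
  proof (rule continuous_on_compose2[of UNIV g])
    show "continuous_on UNIV (\<lambda>v i. Z (t i) \<omega> + t i * a v)"
      by (intro continuous_on_coordinatewise_then_product continuous_on_add continuous_on_mult continuous_on_const a)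
  qed (use tg in auto)
  show "continuous_on UNIV (\<lambda>v. \<integral>w. g (\<lambda>i. w (t i)) \<partial>kernel a v)"
    unfolding eq
  proof (rule continuous_on_sequentiallyI)
    fix vs and v :: "real ^ 'k" assume vs: "vs \<longlonglongrightarrow> v"
    show "(\<lambda>n. \<integral>\<omega>. g (\<lambda>i. Z (t i) \<omega> + t i * a (vs n)) \<partial>M) \<longlonglongrightarrow> (\<integral>\<omega>. g (\<lambda>i. Z (t i) \<omega> + t i * a v) \<partial>M)"
    proof (rule integral_dominated_convergence[where w = "\<lambda>_. C"])
      show "AE \<omega> in M. (\<lambda>n. g (\<lambda>i. Z (t i) \<omega> + t i * a (vs n))) \<longlonglongrightarrow> g (\<lambda>i. Z (t i) \<omega> + t i * a v)"
        using continuous_on_tendsto_compose[OF gc vs] by auto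
    qed (use gZ C in auto)
  qed
qed

text \<open>For u = 0 the law of \<open>V\<close> is the point mass at 0, and \<open>x\<close> is 0.
  For u > 0 a box around \<open>x\<close> inside \<open>U\<close> has positive probability, the
  product over independent nondegenerate components.\<close>

lemma V_support:
  assumes x: "u = 0 \<longrightarrow> x = 0" and U: "open U" "x \<in> U"
  shows "emeasure (distr M borel V) U \<noteq> 0"
proof (cases "u = 0")
  case True
  have "AE \<omega> in M. \<forall>i. X i u \<omega> = 0"
    unfolding True by (rule eventually_all_finite) (rule gmsiD(7))
  then have "AE \<omega> in M. V \<omega> \<in> U"
  proof eventually_elim
    case (elim \<omega>)
    then have "V \<omega> = 0" by (simp add: V_def vec_eq_iff)
    then have "V \<omega> = x" using x True by metis
    then show ?case using U by simp
  qed
  then have "AE v in distr M borel V. v \<in> U"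
    using U V_measurable by (subst AE_distr_iff) auto
  then have "emeasure (distr M borel V) U = 1"
    using U by (intro prob_space.emeasure_eq_1_AE[OF prob_space_distr[OF V_measurable]]) auto
  then show ?thesis by simp
next
  case False
  obtain A where A: "\<And>i. open (A i)" "\<And>i. x $ i \<in> A i" "\<And>y. (\<And>i. y $ i \<in> A i) \<Longrightarrow> y \<in> U"
    using U unfolding open_vec_def by metis
  have ind: "indep_vars (\<lambda>_. borel) (\<lambda>i. X i u) UNIV"
  proof -
    have "indep_vars (\<lambda>_. borel) (\<lambda>i \<omega>. path_map T (X i) \<omega> u) UNIV"
      using uT by (intro indep_vars_compose2[OF indep] measurable_component_singleton) auto
    then show ?thesis using uT by (simp add: path_map_def)
  qed
  have pos: "prob (X i u -` A i \<inter> space M) \<noteq> 0" for i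
  proof -
    have "(\<integral>\<omega>. (X i u \<omega>)\<^sup>2 \<partial>M) \<noteq> 0"
      using gmsiD(10)[OF uT uT, of i] pos_u[of i] False by (simp add: power2_eq_square)
    then have "emeasure M (X i u -` A i \<inter> space M) \<noteq> 0"
      using gaussian_G base_G[OF uT, of i] A(1,2)[of i]
      by (intro nondegenerate_gaussian_open[OF prob_space_axioms]) (auto simp: gaussian_space_def)
    then show ?thesis by (simp add: emeasure_eq_measure)
  qed
  have "prob (\<Inter>i\<in>UNIV. X i u -` A i \<inter> space M) = (\<Prod>i\<in>UNIV. prob (X i u -` A i \<inter> space M))"
    using A(1) by (intro indep_varsD_finite[OF ind]) auto
  then have "prob (\<Inter>i\<in>UNIV. X i u -` A i \<inter> space M) \<noteq> 0" using pos by simp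
  moreover have "prob (\<Inter>i\<in>UNIV. X i u -` A i \<inter> space M) \<le> prob (V -` U \<inter> space M)"
    using A(3) U V_measurable by (intro finite_measure_mono) (auto simp: V_def)
  ultimately have "prob (V -` U \<inter> space M) \<noteq> 0" using measure_nonneg[of M "\<Inter>i\<in>UNIV. X i u -` A i \<inter> space M"] by linarith
  then show ?thesis using U V_measurable by (simp add: emeasure_distr emeasure_eq_measure)
qed

lemma \<tau>_bound:
  "ereal (\<Sum>i\<in>UNIV. (k i)\<^sup>2 * (\<theta> i / (\<theta> i / \<tau> i - u))) \<le> ereal (\<Sum>i\<in>UNIV. (k i)\<^sup>2 * \<theta> i) / (\<Delta> - ereal u)"
proof (cases \<Delta>)
  case (real d)
  then have "u < d" using u by simp
  then have "c i \<le> 1 / (d - u)" for i using c_le[of i] real by (simp add: one_ereal_def)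
  then have "(\<Sum>i\<in>UNIV. (k i)\<^sup>2 * \<theta> i * c i) \<le> (\<Sum>i\<in>UNIV. (k i)\<^sup>2 * \<theta> i * (1 / (d - u)))"
    by (intro sum_mono mult_left_mono weight_nonneg)
  then show ?thesis using real \<open>u < d\<close> by (simp add: c_def sum_divide_distrib)
next
  case PInf
  then have "c i \<le> 0" for i using c_le[of i] by simp
  then have "(\<Sum>i\<in>UNIV. (k i)\<^sup>2 * \<theta> i * c i) \<le> 0"
    by (intro sum_nonpos mult_nonneg_nonpos weight_nonneg)
  then show ?thesis using PInf by (simp add: c_def)
qed (use u in simp)

text \<open>Gaussianity, means and covariances are carried from \<open>Z\<close> to the coordinates
  of the path space; \<open>gmsi_processI\<close> derives the Markov property and stationarity of
  the increments there.\<close>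

lemma gmsi_Z_law:
  "gmsi_process (distr M (path_space T') (path_map T' Z)) (\<lambda>h w. w h)
    (\<Sum>i\<in>UNIV. (k i)\<^sup>2 * \<theta> i) (\<Sum>i\<in>UNIV. (k i)\<^sup>2 * (\<theta> i / (\<theta> i / \<tau> i - u))) (\<Delta> - ereal u)"
proof (rule gmsi_processI)
  let ?D = "distr M (path_space T') (path_map T' Z)"
  have pm: "path_map T' Z \<in> measurable M (path_space T')"
    using Z_measurable Z_continuous by (intro measurable_path_map)
  note co = measurable_path_space_coordinate
  show "0 < \<Delta> - ereal u" using u by (cases \<Delta>) auto
  obtain i0 where "k i0 \<noteq> 0" using k_nz by blast
  then show "0 < (\<Sum>i\<in>UNIV. (k i)\<^sup>2 * \<theta> i)"
    using gmsiD(2)[of i0] by (intro sum_pos2[of UNIV i0] weight_nonneg) auto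
  show "ereal (\<Sum>i\<in>UNIV. (k i)\<^sup>2 * (\<theta> i / (\<theta> i / \<tau> i - u))) \<le> ereal (\<Sum>i\<in>UNIV. (k i)\<^sup>2 * \<theta> i) / (\<Delta> - ereal u)"
    by (rule \<tau>_bound)
  show "prob_space ?D" by (rule prob_space_distr[OF pm])
  show "(\<lambda>w. w t) \<in> borel_measurable ?D" if "t \<in> T'" for t using co[OF that] by simp
  show "continuous_on T' (\<lambda>t. w t)" if "w \<in> space ?D" for w
    using that by (simp add: path_space_def space_restrict_space)
  have "Z 0 \<omega> = 0" for \<omega> by (simp add: Z_def R_def)
  then show "AE w in ?D. w 0 = 0"
    using zero_T' measurable_sets_Collect[OF co[OF zero_T'], of "\<lambda>r. r = 0"]
    by (subst AE_distr_iff[OF pm]) (auto simp: path_map_def)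
  show "(\<integral>w. w t \<partial>?D) = 0" if t: "t \<in> T'" for t
    using gaussian_G Z_G[OF t] t
    by (subst integral_distr[OF pm co[OF t]]) (simp add: path_map_def gaussian_space_def)
  show "gaussian_process ?D T' (\<lambda>h w. w h)"
    unfolding gaussian_process_def
  proof (intro allI impI, elim conjE)
    fix J b assume J: "finite J" "J \<subseteq> T'"
    have "(\<lambda>\<omega>. \<Sum>t\<in>J. b t * Z t \<omega>) \<in> G"
      using J Z_G by (intro gaussian_space_sum[OF gaussian_G]) auto
    then have "gaussian_rv M (\<lambda>\<omega>. \<Sum>t\<in>J. b t * Z t \<omega>)" using gaussian_G by (simp add: gaussian_space_def)
    also have "(\<lambda>\<omega>. \<Sum>t\<in>J. b t * Z t \<omega>) = (\<lambda>\<omega>. \<Sum>t\<in>J. b t * path_map T' Z \<omega> t)"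
      using J by (intro ext sum.cong) (auto simp: path_map_def)
    finally show "gaussian_rv ?D (\<lambda>w. \<Sum>t\<in>J. b t * w t)"
      using J by (intro gaussian_rv_distr[OF pm] borel_measurable_sum borel_measurable_times co) auto
  qed
  show "(\<integral>w. w s * w t \<partial>?D) =
      s * ((\<Sum>i\<in>UNIV. (k i)\<^sup>2 * \<theta> i) - (\<Sum>i\<in>UNIV. (k i)\<^sup>2 * (\<theta> i / (\<theta> i / \<tau> i - u))) * t)"
    if st: "s \<in> T'" "t \<in> T'" "s \<le> t" for s t
    using Z_covariance[OF st] st
    by (subst integral_distr[OF pm borel_measurable_times[OF co[OF st(1)] co[OF st(2)]]]) (simp add: path_map_def)
qed

end

theorem proposition2:
  fixes M :: "'a measure"
    and X :: "'k::finite \<Rightarrow> real \<Rightarrow> 'a \<Rightarrow> real"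
    and \<theta> \<tau> k :: "'k \<Rightarrow> real"
    and \<Delta> :: ereal
    and u :: real
    and x :: "real ^ 'k"
  defines "S \<equiv> \<lambda>t \<omega>. \<Sum>i\<in>UNIV. k i * X i t \<omega>"
  defines "Y \<equiv> \<lambda>h \<omega>. S (u + h) \<omega> - S u \<omega> + h * (\<Sum>i\<in>UNIV. k i * x $ i / (\<theta> i / \<tau> i - u))"
  defines "V \<equiv> \<lambda>\<omega>. (\<chi> i. X i u \<omega>) :: real ^ 'k"
  defines "\<theta>' \<equiv> \<Sum>i\<in>UNIV. (k i)\<^sup>2 * \<theta> i"
  defines "\<tau>' \<equiv> \<Sum>i\<in>UNIV. (k i)\<^sup>2 * (\<theta> i / (\<theta> i / \<tau> i - u))"
  assumes "prob_space M"
    and "\<And>i. \<theta> i > 0"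
    and "\<And>i. \<tau> i \<noteq> 0"
    and "0 < \<Delta>"
    and "(\<exists>i. \<tau> i > 0) \<longrightarrow> \<Delta> \<le> ereal (Min {\<theta> i / \<tau> i | i. \<tau> i > 0})"
    and "\<And>i. gmsi_process M (X i) (\<theta> i) (\<tau> i) \<Delta>"
    and "prob_space.indep_vars M (\<lambda>i. \<Pi>\<^sub>M t\<in>time_interval \<Delta>. borel)
           (\<lambda>i. path_map (time_interval \<Delta>) (X i)) UNIV"
    and "\<exists>i. k i \<noteq> 0"
    and "0 \<le> u" and "ereal u < \<Delta>"
    and "u = 0 \<longrightarrow> x = 0"
  shows "(\<exists>\<kappa>. continuous_conditional_law M (time_interval (\<Delta> - ereal u)) Y V \<kappa>) \<and>
         (\<forall>\<kappa>. continuous_conditional_law M (time_interval (\<Delta> - ereal u)) Y V \<kappa> \<longrightarrow>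
            gmsi_process (\<kappa> x) (\<lambda>h w. w h) \<theta>' \<tau>' (\<Delta> - ereal u)) \<and>
         ereal \<tau>' \<le> ereal \<theta>' / (\<Delta> - ereal u)"
proof -
  interpret L: gmsi_mixture M X \<theta> \<tau> k \<Delta> u
    by unfold_locales (use assms in auto)
  define a where "a v = (\<Sum>i\<in>UNIV. k i * L.c i * (x $ i - v $ i))" for v :: "real ^ 'k"
  have V: "V = L.V" by (simp add: V_def L.V_def[abs_def])
  have Y: "Y h \<omega> = L.Z h \<omega> + h * a (L.V \<omega>)" for h \<omega>
  proof -
    have "k i * x $ i / (\<theta> i / \<tau> i - u) = k i * L.c i * x $ i" for i by (simp add: L.c_def)
    then show ?thesis
      unfolding Y_def S_def a_def L.Z_def L.R_def L.V_def
      by (simp add: sum_distrib_left flip: sum.distrib sum_subtractf) (simp add: algebra_simps)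
  qed
  have "continuous_on UNIV a" unfolding a_def by (intro continuous_intros)
  then have \<kappa>: "continuous_conditional_law M (time_interval (\<Delta> - ereal u)) Y V (L.kernel a)"
    unfolding V using Y by (intro L.kernel_continuous)
  have x: "L.kernel a x = distr M (path_space (time_interval (\<Delta> - ereal u))) (path_map (time_interval (\<Delta> - ereal u)) L.Z)"
    by (simp add: L.kernel_def a_def)
  have uniq: "\<kappa>' x = L.kernel a x" if "continuous_conditional_law M (time_interval (\<Delta> - ereal u)) Y V \<kappa>'" for \<kappa>'
  proof (rule continuous_conditional_law_unique[OF L.prob_space_axioms _ _ that \<kappa>])
    show "V \<in> borel_measurable M" unfolding V by (rule L.V_measurable)
    show "time_interval (\<Delta> - ereal u) \<noteq> {}" using L.zero_T' by blast
    \<comment> \<open>The hypothesis on \<open>x\<close> at u = 0 enters here: a continuous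
      conditional law is pinned down only on the support of the law of \<open>V\<close>.\<close>
    show "emeasure (distr M borel V) U \<noteq> 0" if "open U" "x \<in> U" for U
      unfolding V using that assms(16) by (intro L.V_support)
  qed
  \<comment> \<open>An arbitrary continuous conditional law is replaced at \<open>x\<close> by the
    explicit kernel, whose drift is zero there.\<close>
  show ?thesis
    unfolding \<theta>'_def \<tau>'_def
    by (intro conjI exI allI impI, rule \<kappa>, subst uniq, assumption, unfold x, rule L.gmsi_Z_law, rule L.\<tau>_bound)
qed

end
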